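(* Let $\mathbb{K}$ be an algebraically closed field of characteristic zero, let $k\ge 1$ and $m\ge 2$ be integers, let $L_{(k)}(m)$ be the free $k$-step nilpotent Lie algebra over $\mathbb{K}$ on $m$ generators, and let $n=\dim L_{(k)}(m)$. If $L_{(k)}(m)$ is not isomorphic to $L_{(2)}(2)$, then $L_{(k)}(m)$ is non-rigid in $\mathcal{N}_{n,k+1}$.
   Context: $L_{(k)}(m)=L(m)/L^{k+1}(m)$, where $L(m)$ is the free Lie algebra over $\mathbb{K}$ on $m$ generators and $L^{k+1}(m)$ is the $(k+1)$-th term of its descending central series ($L^1=L$, $L^{i+1}=[L^i,L]$). For a bracket $\mu$, set $\mu^1=\mu$ and $\mu^{j}(x_1,\dots,x_{j+1})=\mu(\mu^{j-1}(x_1,\dots,x_j),x_{j+1})$. $\mathcal{N}_{n,j}$ is the affine algebraic variety (with Zariski topology) of all Lie brackets $\mu:\mathbb{K}^n\times\mathbb{K}^n\to\mathbb{K}^n$ with $\mu^j=0$, i.e. nilpotent of nilpotency index at most $j$ (abelian Lie algebras count as $1$-step nilpotent). $\operatorname{GL}_n(\mathbb{K})$ acts by change of basis, $(g\cdot\mu)(x,y)=g\mu(g^{-1}x,g^{-1}y)$, and the orbits are the isomorphism classes. A Lie bracket $\mu\in\mathcal{N}_{n,j}$ is rigid in $\mathcal{N}_{n,j}$ if its orbit is Zariski open in $\mathcal{N}_{n,j}$; otherwise it is non-rigid. A Lie algebra of dimension $n$ is identified with its bracket via any choice of basis.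
   Formalization: The case k = 1, m = 2 is excluded: there the algebra is abelian of dimension 2, the variety of 2-step nilpotent brackets on a plane is the single point 0, and so the algebra is rigid. *)

theory Defs
  imports "HOL-Analysis.Analysis" "HOL-Computational_Algebra.Polynomial"
    "HOL-Library.Poly_Mapping"
begin

section \<open>Algebras with a bracket, on explicit carriers\<close>

text \<open>Explicit carriers make it possible to iterate the formation of quotients. The scalars
  are the elements of a field given as a type; no axioms are imposed on the bracket.\<close>

record ('k, 'a) balg =
  carr :: "'a set"
  zer :: 'a
  add :: "'a \<Rightarrow> 'a \<Rightarrow> 'a"
  scl :: "'k \<Rightarrow> 'a \<Rightarrow> 'a"
  brk :: "'a \<Rightarrow> 'a \<Rightarrow> 'a"

definition lin_subspace :: "('k, 'a) balg \<Rightarrow> 'a set \<Rightarrow> bool" where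
  "lin_subspace A W \<longleftrightarrow> W \<subseteq> carr A \<and> zer A \<in> W \<and>
     (\<forall>x\<in>W. \<forall>y\<in>W. add A x y \<in> W) \<and> (\<forall>c. \<forall>x\<in>W. scl A c x \<in> W)"

definition lin_span :: "('k, 'a) balg \<Rightarrow> 'a set \<Rightarrow> 'a set" where
  "lin_span A S = \<Inter>{W. lin_subspace A W \<and> S \<subseteq> W}"

definition lin_basis :: "('k, 'a) balg \<Rightarrow> 'a set \<Rightarrow> bool" where
  "lin_basis A B \<longleftrightarrow> B \<subseteq> carr A \<and> lin_span A B = carr A \<and> (\<forall>b\<in>B. b \<notin> lin_span A (B - {b}))"

text \<open>As for the library's \<^verbatim>\<open>dim\<close>, the value is \<open>0\<close> if the dimension is infinite.\<close>

definition balg_dim :: "('k, 'a) balg \<Rightarrow> nat" where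
  "balg_dim A = card (SOME B. lin_basis A B)"

definition is_ideal :: "('k, 'a) balg \<Rightarrow> 'a set \<Rightarrow> bool" where
  "is_ideal A I \<longleftrightarrow> lin_subspace A I \<and>
     (\<forall>x\<in>I. \<forall>y\<in>carr A. brk A x y \<in> I \<and> brk A y x \<in> I)"

definition ideal_gen :: "('k, 'a) balg \<Rightarrow> 'a set \<Rightarrow> 'a set" where
  "ideal_gen A S = \<Inter>{I. is_ideal A I \<and> S \<subseteq> I}"

definition coset :: "('k, 'a) balg \<Rightarrow> 'a set \<Rightarrow> 'a \<Rightarrow> 'a set" where
  "coset A I x = add A x ` I"

text \<open>The elements of \<open>A/I\<close> are the cosets of \<open>I\<close>. When \<open>I\<close> is an ideal, all members of the
  unions defining the operations coincide.\<close>

definition quot :: "('k, 'a) balg \<Rightarrow> 'a set \<Rightarrow> ('k, 'a set) balg" where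
  "quot A I = \<lparr> carr = coset A I ` carr A,
     zer = coset A I (zer A),
     add = (\<lambda>X Y. \<Union>x\<in>X. \<Union>y\<in>Y. coset A I (add A x y)),
     scl = (\<lambda>c X. \<Union>x\<in>X. coset A I (scl A c x)),
     brk = (\<lambda>X Y. \<Union>x\<in>X. \<Union>y\<in>Y. coset A I (brk A x y)) \<rparr>"

text \<open>\<open>lcs A i\<close> is \<open>A\<^sup>i\<close> for \<open>i \<ge> 1\<close>, with \<open>A\<^sup>1 = A\<close>; the index \<open>0\<close> is not used.\<close>

fun lcs :: "('k, 'a) balg \<Rightarrow> nat \<Rightarrow> 'a set" where
  "lcs A 0 = carr A"
| "lcs A (Suc 0) = carr A"
| "lcs A (Suc (Suc i)) = lin_span A {brk A x y | x y. x \<in> lcs A (Suc i) \<and> y \<in> carr A}"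

definition balg_iso :: "('k, 'a) balg \<Rightarrow> ('k, 'b) balg \<Rightarrow> bool" where
  "balg_iso A B \<longleftrightarrow> (\<exists>f. bij_betw f (carr A) (carr B) \<and>
     (\<forall>x\<in>carr A. \<forall>y\<in>carr A. f (add A x y) = add B (f x) (f y)) \<and>
     (\<forall>c. \<forall>x\<in>carr A. f (scl A c x) = scl B c (f x)) \<and>
     (\<forall>x\<in>carr A. \<forall>y\<in>carr A. f (brk A x y) = brk B (f x) (f y)))"

section \<open>Free and free nilpotent Lie algebras\<close>

text \<open>The free nonassociative algebra on \<open>m\<close> generators has the free magma on \<open>{0..<m}\<close> as a
  basis; the free Lie algebra is its quotient by the ideal generated by the squares and the
  Jacobi expressions.\<close>

datatype magma = Gen nat | Mul magma magma

fun gens :: "magma \<Rightarrow> nat set" where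
  "gens (Gen i) = {i}"
| "gens (Mul s t) = gens s \<union> gens t"

definition magma_brk ::
  "(magma \<Rightarrow>\<^sub>0 'k::field) \<Rightarrow> (magma \<Rightarrow>\<^sub>0 'k) \<Rightarrow> (magma \<Rightarrow>\<^sub>0 'k)" where
  "magma_brk p q = (\<Sum>s\<in>Poly_Mapping.keys p. \<Sum>t\<in>Poly_Mapping.keys q.
     Poly_Mapping.single (Mul s t) (Poly_Mapping.lookup p s * Poly_Mapping.lookup q t))"

definition magma_alg :: "nat \<Rightarrow> ('k::field, magma \<Rightarrow>\<^sub>0 'k) balg" where
  "magma_alg m = \<lparr> carr = {p. \<forall>t\<in>Poly_Mapping.keys p. gens t \<subseteq> {..<m}},
     zer = 0, add = (+), scl = (\<lambda>c. Poly_Mapping.map ((*) c)), brk = magma_brk \<rparr>"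

definition lie_relators :: "('k, 'a) balg \<Rightarrow> 'a set" where
  "lie_relators A = {brk A x x | x. x \<in> carr A} \<union>
     {add A (brk A x (brk A y z)) (add A (brk A y (brk A z x)) (brk A z (brk A x y)))
       | x y z. x \<in> carr A \<and> y \<in> carr A \<and> z \<in> carr A}"

definition free_lie :: "nat \<Rightarrow> ('k::field, (magma \<Rightarrow>\<^sub>0 'k) set) balg" where
  "free_lie m = quot (magma_alg m) (ideal_gen (magma_alg m) (lie_relators (magma_alg m)))"

definition free_nilp :: "nat \<Rightarrow> nat \<Rightarrow> ('k::field, (magma \<Rightarrow>\<^sub>0 'k) set set) balg" where
  "free_nilp k m = quot (free_lie m) (lcs (free_lie m) (k + 1))"

section \<open>The Zariski topology on affine space\<close>

text \<open>Affine space over \<open>'k\<close> with coordinates indexed by \<open>'i\<close> is the type \<open>'i \<Rightarrow> 'k\<close>.\<close>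

inductive_set polyfun :: "(('i \<Rightarrow> 'k::comm_ring_1) \<Rightarrow> 'k) set" where
  const: "(\<lambda>x. c) \<in> polyfun"
| coord: "(\<lambda>x. x i) \<in> polyfun"
| add: "p \<in> polyfun \<Longrightarrow> q \<in> polyfun \<Longrightarrow> (\<lambda>x. p x + q x) \<in> polyfun"
| mult: "p \<in> polyfun \<Longrightarrow> q \<in> polyfun \<Longrightarrow> (\<lambda>x. p x * q x) \<in> polyfun"

definition zero_locus :: "(('i \<Rightarrow> 'k) \<Rightarrow> 'k::comm_ring_1) set \<Rightarrow> ('i \<Rightarrow> 'k) set" where
  "zero_locus P = {x. \<forall>p\<in>P. p x = 0}"

definition zariski :: "('i \<Rightarrow> 'k::idom) topology" where
  "zariski = topology (\<lambda>U. \<exists>P\<subseteq>polyfun. U = - zero_locus P)"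

lemma istopology_zariski:
  "istopology (\<lambda>U :: ('i \<Rightarrow> 'k::idom) set. \<exists>P\<subseteq>polyfun. U = - zero_locus P)"
  unfolding istopology_def
proof safe
  fix P Q :: "(('i \<Rightarrow> 'k) \<Rightarrow> 'k) set"
  assume P: "P \<subseteq> polyfun" and Q: "Q \<subseteq> polyfun"
  let ?R = "{\<lambda>x. p x * q x | p q. p \<in> P \<and> q \<in> Q}"
  have "?R \<subseteq> polyfun"
    using P Q by (auto intro: polyfun.mult)
  moreover have "- zero_locus P \<inter> - zero_locus Q = - zero_locus ?R"
    by (fastforce simp: zero_locus_def)
  ultimately show "\<exists>R\<subseteq>polyfun. - zero_locus P \<inter> - zero_locus Q = - zero_locus R"
    by blast
next
  fix \<U> :: "('i \<Rightarrow> 'k) set set"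
  assume "\<forall>U\<in>\<U>. \<exists>P\<subseteq>polyfun. U = - zero_locus P"
  then obtain F where F: "\<And>U. U \<in> \<U> \<Longrightarrow> F U \<subseteq> polyfun \<and> U = - zero_locus (F U)"
    by metis
  have "\<Union>\<U> = (\<Union>U\<in>\<U>. - zero_locus (F U))"
    using F by auto
  also have "\<dots> = - zero_locus (\<Union>U\<in>\<U>. F U)"
    by (auto simp: zero_locus_def)
  finally show "\<exists>P\<subseteq>polyfun. \<Union>\<U> = - zero_locus P"
    using F by (intro exI[of _ "\<Union>U\<in>\<U>. F U"]) blast
qed

lemma openin_zariski:
  "openin zariski (U :: ('i \<Rightarrow> 'k::idom) set) \<longleftrightarrow> (\<exists>P\<subseteq>polyfun. U = - zero_locus P)"
  unfolding zariski_def by (subst topology_inverse'[OF istopology_zariski]) (rule refl)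

section \<open>The variety of nilpotent Lie brackets\<close>

type_synonym ('k, 'n) bracket = "'k^'n \<Rightarrow> 'k^'n \<Rightarrow> 'k^'n"

definition lie_bracket :: "('k::field, 'n::finite) bracket \<Rightarrow> bool" where
  "lie_bracket \<mu> \<longleftrightarrow>
     (\<forall>x. Vector_Spaces.linear (*s) (*s) (\<mu> x)) \<and>
     (\<forall>y. Vector_Spaces.linear (*s) (*s) (\<lambda>x. \<mu> x y)) \<and>
     (\<forall>x. \<mu> x x = 0) \<and>
     (\<forall>x y z. \<mu> x (\<mu> y z) + \<mu> y (\<mu> z x) + \<mu> z (\<mu> x y) = 0)"

text \<open>\<open>foldl \<mu> x\<^sub>1 [x\<^sub>2, \<dots>, x\<^sub>j\<^sub>+\<^sub>1] = \<mu> (\<dots> (\<mu> (\<mu> x\<^sub>1 x\<^sub>2) x\<^sub>3) \<dots>) x\<^sub>j\<^sub>+\<^sub>1\<close> is the iterated bracket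
  \<open>\<mu>\<^sup>j\<close>.\<close>

definition nilp_brackets :: "nat \<Rightarrow> ('k::field, 'n::finite) bracket set" where
  "nilp_brackets j = {\<mu>. lie_bracket \<mu> \<and> (\<forall>x xs. length xs = j \<longrightarrow> foldl \<mu> x xs = 0)}"

definition act ::
  "'k::field^'n^'n \<Rightarrow> ('k, 'n::finite) bracket \<Rightarrow> ('k, 'n) bracket" where
  "act g \<mu> = (\<lambda>x y. g *v \<mu> (matrix_inv g *v x) (matrix_inv g *v y))"

definition orbit :: "('k::field, 'n::finite) bracket \<Rightarrow> ('k, 'n) bracket set" where
  "orbit \<mu> = {act g \<mu> | g. invertible g}"

text \<open>The structure constants identify the space of bilinear maps with an affine space of
  dimension \<open>n\<^sup>3\<close>.\<close>

definition struct_consts :: "('k::field, 'n::finite) bracket \<Rightarrow> 'n \<times> 'n \<times> 'n \<Rightarrow> 'k" where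
  "struct_consts \<mu> = (\<lambda>(i, j, l). \<mu> (axis i 1) (axis j 1) $ l)"

definition rigid_in :: "nat \<Rightarrow> ('k::field, 'n::finite) bracket \<Rightarrow> bool" where
  "rigid_in j \<mu> \<longleftrightarrow> \<mu> \<in> nilp_brackets j \<and>
     openin (subtopology zariski (struct_consts ` nilp_brackets j)) (struct_consts ` orbit \<mu>)"

definition nonrigid_in :: "nat \<Rightarrow> ('k::field, 'n::finite) bracket \<Rightarrow> bool" where
  "nonrigid_in j \<mu> \<longleftrightarrow> \<mu> \<in> nilp_brackets j \<and> \<not> rigid_in j \<mu>"

definition coord_alg :: "('k::field, 'n::finite) bracket \<Rightarrow> ('k, 'k^'n) balg" where
  "coord_alg \<mu> = \<lparr> carr = UNIV, zer = 0, add = (+), scl = (*s), brk = \<mu> \<rparr>"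

end

theory Submission
  imports Defs
begin

text \<open>Let \<open>x\<^sub>1, \<dots>, x\<^sub>m\<close> be the generators of \<open>L = L\<^sub>(\<^sub>k\<^sub>)(m)\<close>. The assignment \<open>x\<^sub>1 \<mapsto> x\<close>,
  \<open>x\<^sub>2 \<mapsto> e\<^sub>1\<close>, \<open>x\<^sub>i \<mapsto> 0\<close> for \<open>i \<ge> 3\<close> extends to a homomorphism \<open>\<Phi>\<close> to the \<open>k\<close>-step filiform Lie
  algebra with \<open>[x, e\<^sub>i] = e\<^sub>i\<^sub>+\<^sub>1\<close>. Let \<open>\<alpha>\<close> and \<open>\<beta>\<close> be the coordinates of \<open>\<Phi>\<close> along \<open>x\<close> and \<open>e\<^sub>k\<close>,
  and let \<open>z \<noteq> 0\<close> be an element of \<open>L\<^sup>k\<close>, hence central, with \<open>\<Phi> z = 0\<close>; it exists unless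
  \<open>m = 2\<close> and \<open>k \<le> 2\<close>. Then \<open>\<mu> + t (\<alpha> \<and> \<beta>) z\<close> is for every \<open>t\<close> a Lie bracket in \<open>N\<^sub>n\<^sub>,\<^sub>k\<^sub>+\<^sub>1\<close>, and for
  \<open>t \<noteq> 0\<close> it is not \<open>k\<close>-step nilpotent, since bracketing \<open>k\<close> times with \<open>x\<^sub>1\<close> takes \<open>x\<^sub>2\<close> to a nonzero
  multiple of \<open>z\<close>. A Zariski open orbit of \<open>\<mu>\<close> would contain a member of this line other than
  \<open>\<mu>\<close>.\<close>

section \<open>Bilinear algebras, homomorphisms and quotients\<close>

text \<open>Antisymmetry and the Jacobi identity are left out so that the free nonassociative
  algebra is an instance; being Lie is expressed separately by
  \<open>lie_relators A \<subseteq> {zer A}\<close>. Negatives are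
  \<open>scl A (- 1) x\<close>.\<close>

locale bilinear_algebra =
  fixes A :: "('k::field, 'a) balg"
  assumes zer_closed: "zer A \<in> carr A"
    and add_closed: "\<lbrakk>x \<in> carr A; y \<in> carr A\<rbrakk> \<Longrightarrow> add A x y \<in> carr A"
    and scl_closed: "x \<in> carr A \<Longrightarrow> scl A c x \<in> carr A"
    and brk_closed: "\<lbrakk>x \<in> carr A; y \<in> carr A\<rbrakk> \<Longrightarrow> brk A x y \<in> carr A"
    and add_assoc: "\<lbrakk>x \<in> carr A; y \<in> carr A; z \<in> carr A\<rbrakk> \<Longrightarrow>
      add A (add A x y) z = add A x (add A y z)"
    and add_commute: "\<lbrakk>x \<in> carr A; y \<in> carr A\<rbrakk> \<Longrightarrow> add A x y = add A y x"
    and add_zer: "x \<in> carr A \<Longrightarrow> add A (zer A) x = x"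
    and scl_zero: "x \<in> carr A \<Longrightarrow> scl A 0 x = zer A"
    and scl_one: "x \<in> carr A \<Longrightarrow> scl A 1 x = x"
    and scl_scl: "x \<in> carr A \<Longrightarrow> scl A c (scl A d x) = scl A (c * d) x"
    and scl_add_left: "x \<in> carr A \<Longrightarrow> scl A (c + d) x = add A (scl A c x) (scl A d x)"
    and scl_add_right: "\<lbrakk>x \<in> carr A; y \<in> carr A\<rbrakk> \<Longrightarrow>
      scl A c (add A x y) = add A (scl A c x) (scl A c y)"
    and brk_add_left: "\<lbrakk>x \<in> carr A; y \<in> carr A; z \<in> carr A\<rbrakk> \<Longrightarrow>
      brk A (add A x y) z = add A (brk A x z) (brk A y z)"
    and brk_add_right: "\<lbrakk>x \<in> carr A; y \<in> carr A; z \<in> carr A\<rbrakk> \<Longrightarrow>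
      brk A z (add A x y) = add A (brk A z x) (brk A z y)"
    and brk_scl_left: "\<lbrakk>x \<in> carr A; y \<in> carr A\<rbrakk> \<Longrightarrow> brk A (scl A c x) y = scl A c (brk A x y)"
    and brk_scl_right: "\<lbrakk>x \<in> carr A; y \<in> carr A\<rbrakk> \<Longrightarrow> brk A x (scl A c y) = scl A c (brk A x y)"
begin

lemmas closed = zer_closed add_closed scl_closed brk_closed

lemma add_zer_right: "x \<in> carr A \<Longrightarrow> add A x (zer A) = x"
  using add_commute add_zer zer_closed by metis

lemma add_neg: "x \<in> carr A \<Longrightarrow> add A x (scl A (- 1) x) = zer A"
  using scl_add_left[of x 1 "- 1"] by (simp add: scl_one scl_zero)

lemma add_neg_left: "x \<in> carr A \<Longrightarrow> add A (scl A (- 1) x) x = zer A"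
  using add_neg add_commute closed by metis

lemma scl_zer: "scl A c (zer A) = zer A"
  using scl_scl[of "zer A" c 0] by (simp add: scl_zero zer_closed)

lemma add_left_commute:
  assumes "x \<in> carr A" "y \<in> carr A" "z \<in> carr A"
  shows "add A x (add A y z) = add A y (add A x z)"
  using assms by (metis add_assoc add_commute)

lemma eq_of_diff_zer:
  assumes "x \<in> carr A" "y \<in> carr A" "add A x (scl A (- 1) y) = zer A"
  shows "x = y"
proof -
  have "x = add A x (add A (scl A (- 1) y) y)"
    using assms by (simp add: add_neg_left add_zer_right)
  also have "\<dots> = add A (zer A) y"
    using assms by (simp add: add_assoc[symmetric] scl_closed)
  finally show ?thesis
    using assms by (simp add: add_zer)
qed

lemma brk_zer_left: "y \<in> carr A \<Longrightarrow> brk A (zer A) y = zer A"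
  using brk_scl_left[of "zer A" y 0] by (simp add: scl_zero closed)

lemma brk_zer_right: "y \<in> carr A \<Longrightarrow> brk A y (zer A) = zer A"
  using brk_scl_right[of y "zer A" 0] by (simp add: scl_zero closed)

lemma subspace_carr: "lin_subspace A (carr A)"
  by (simp add: lin_subspace_def closed)

lemma span_subspace: "S \<subseteq> carr A \<Longrightarrow> lin_subspace A (lin_span A S)"
  using subspace_carr by (auto simp: lin_span_def lin_subspace_def)

lemma ideal_gen_is_ideal:
  assumes S: "S \<subseteq> carr A"
  shows "is_ideal A (ideal_gen A S)"
proof -
  have "is_ideal A (carr A)"
    by (simp add: is_ideal_def subspace_carr closed)
  then show ?thesis
    using S by (auto simp: ideal_gen_def is_ideal_def lin_subspace_def)
qed

lemma lie_relators_closed: "lie_relators A \<subseteq> carr A"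
  by (auto simp: lie_relators_def intro!: closed)

end

lemma span_superset: "S \<subseteq> lin_span A S"
  by (auto simp: lin_span_def)

lemma span_minimal: "\<lbrakk>lin_subspace A W; S \<subseteq> W\<rbrakk> \<Longrightarrow> lin_span A S \<subseteq> W"
  by (auto simp: lin_span_def)

lemma span_mono: "S \<subseteq> T \<Longrightarrow> lin_span A S \<subseteq> lin_span A T"
  by (auto simp: lin_span_def)

definition alg_hom :: "('k, 'a) balg \<Rightarrow> ('k, 'b) balg \<Rightarrow> ('a \<Rightarrow> 'b) \<Rightarrow> bool" where
  "alg_hom A B h \<longleftrightarrow> (\<forall>x\<in>carr A. h x \<in> carr B) \<and>
     (\<forall>x\<in>carr A. \<forall>y\<in>carr A. h (add A x y) = add B (h x) (h y)) \<and>
     (\<forall>c. \<forall>x\<in>carr A. h (scl A c x) = scl B c (h x)) \<and>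
     (\<forall>x\<in>carr A. \<forall>y\<in>carr A. h (brk A x y) = brk B (h x) (h y))"

lemma alg_hom_comp: "\<lbrakk>alg_hom A B h; alg_hom B C g\<rbrakk> \<Longrightarrow> alg_hom A C (g \<circ> h)"
  by (simp add: alg_hom_def)

lemma alg_hom_foldl:
  assumes "bilinear_algebra A" "alg_hom A B h" "x \<in> carr A" "set xs \<subseteq> carr A"
  shows "h (foldl (brk A) x xs) = foldl (brk B) (h x) (map h xs)"
  using assms(3,4)
proof (induction xs arbitrary: x)
  case (Cons y ys)
  then show ?case
    using assms(1,2) by (simp add: alg_hom_def bilinear_algebra.brk_closed)
qed simp

text \<open>Every element of \<open>B\<close> is an image, so each identity can be checked on
  preimages. This serves both for quotients and for moving the free nilpotent algebra to
  coordinates. Zero needs its own assumption, since \<open>alg_hom\<close> does not mention it and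
  the axioms for \<open>B\<close> are still to be shown.\<close>

lemma bilinear_algebra_image:
  assumes "bilinear_algebra A" and h: "alg_hom A B h" and surj: "carr B = h ` carr A"
    and zer: "zer B = h (zer A)"
  shows "bilinear_algebra B"
proof -
  interpret bilinear_algebra A by fact
  have hom: "add B (h x) (h y) = h (add A x y)" "scl B c (h x) = h (scl A c x)"
    "brk B (h x) (h y) = h (brk A x y)"
    if "x \<in> carr A" "y \<in> carr A" for x y c
    using h that by (simp_all add: alg_hom_def)
  have hom_scl: "scl B c (h x) = h (scl A c x)" if "x \<in> carr A" for x c
    using hom(2) that by blast
  note simps = hom(1,3) hom_scl zer closed
  show ?thesis
  proof
    fix x y z c d assume x: "x \<in> carr B" and y: "y \<in> carr B" and z: "z \<in> carr B"
    obtain x' y' z' where *: "x = h x'" "y = h y'" "z = h z'"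
      "x' \<in> carr A" "y' \<in> carr A" "z' \<in> carr A"
      using x y z surj by auto
    show "add B (add B x y) z = add B x (add B y z)"
      using * by (simp add: simps add_assoc)
    show "brk B (add B x y) z = add B (brk B x z) (brk B y z)"
      using * by (simp add: simps brk_add_left)
    show "brk B z (add B x y) = add B (brk B z x) (brk B z y)"
      using * by (simp add: simps brk_add_right)
  next
    fix x y c assume x: "x \<in> carr B" and y: "y \<in> carr B"
    obtain x' y' where *: "x = h x'" "y = h y'" "x' \<in> carr A" "y' \<in> carr A"
      using x y surj by auto
    show "add B x y \<in> carr B" "brk B x y \<in> carr B"
      using * by (auto simp: simps surj)
    show "add B x y = add B y x"
      using * by (simp add: simps add_commute)
    show "scl B c (add B x y) = add B (scl B c x) (scl B c y)"
      using * by (simp add: simps scl_add_right)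
    show "brk B (scl B c x) y = scl B c (brk B x y)" "brk B x (scl B c y) = scl B c (brk B x y)"
      using * by (simp_all add: simps brk_scl_left brk_scl_right)
  next
    fix x c d assume x: "x \<in> carr B"
    obtain x' where *: "x = h x'" "x' \<in> carr A"
      using x surj by auto
    show "scl B c x \<in> carr B"
      using * by (auto simp: simps surj)
    show "add B (zer B) x = x" "scl B 0 x = zer B" "scl B 1 x = x"
      using * by (simp_all add: simps add_zer scl_zero scl_one)
    show "scl B c (scl B d x) = scl B (c * d) x" "scl B (c + d) x = add B (scl B c x) (scl B d x)"
      using * by (simp_all add: simps scl_scl scl_add_left)
  next
    show "zer B \<in> carr B"
      by (auto simp: simps surj)
  qed
qed

lemma alg_hom_zer:
  assumes "bilinear_algebra A" "bilinear_algebra B" "alg_hom A B h"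
  shows "h (zer A) = zer B"
proof -
  have z: "zer A \<in> carr A"
    using assms(1) by (rule bilinear_algebra.zer_closed)
  have "h (zer A) = h (scl A 0 (zer A))"
    using assms(1) z by (simp add: bilinear_algebra.scl_zero)
  also have "\<dots> = zer B"
    using assms z unfolding alg_hom_def by (metis bilinear_algebra.scl_zero)
  finally show ?thesis .
qed

text \<open>By surjectivity squares and Jacobi expressions of \<open>B\<close> are images of those
  of \<open>A\<close>, so the Lie identities pass to quotients.\<close>

lemma lie_relators_image:
  assumes "bilinear_algebra A" "alg_hom A B h" "carr B = h ` carr A"
  shows "lie_relators B = h ` lie_relators A"
proof -
  interpret bilinear_algebra A by fact
  have sq: "brk B (h x) (h x) = h (brk A x x)" if "x \<in> carr A" for x
    using assms(2) that by (simp add: alg_hom_def)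
  have jac: "add B (brk B (h x) (brk B (h y) (h z)))
      (add B (brk B (h y) (brk B (h z) (h x))) (brk B (h z) (brk B (h x) (h y)))) =
    h (add A (brk A x (brk A y z)) (add A (brk A y (brk A z x)) (brk A z (brk A x y))))"
    if "x \<in> carr A" "y \<in> carr A" "z \<in> carr A" for x y z
    using assms(2) that by (simp add: alg_hom_def closed)
  show ?thesis
    unfolding lie_relators_def assms(3) image_Un
  proof (intro arg_cong2[where f = "(\<union>)"])
    show "{brk B x x |x. x \<in> h ` carr A} = h ` {brk A x x |x. x \<in> carr A}"
      unfolding Setcompr_eq_image image_image by (intro image_cong refl sq)
    show "{add B (brk B x (brk B y z)) (add B (brk B y (brk B z x)) (brk B z (brk B x y)))
        |x y z. x \<in> h ` carr A \<and> y \<in> h ` carr A \<and> z \<in> h ` carr A} =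
      h ` {add A (brk A x (brk A y z)) (add A (brk A y (brk A z x)) (brk A z (brk A x y)))
        |x y z. x \<in> carr A \<and> y \<in> carr A \<and> z \<in> carr A}" (is "?L = ?R")
    proof
      show "?L \<subseteq> ?R"
      proof
        fix w assume "w \<in> ?L"
        then obtain x y z where "w = h (add A (brk A x (brk A y z))
            (add A (brk A y (brk A z x)) (brk A z (brk A x y))))"
          "x \<in> carr A" "y \<in> carr A" "z \<in> carr A"
          using jac by auto
        then show "w \<in> ?R" by blast
      qed
      show "?R \<subseteq> ?L"
      proof
        fix w assume "w \<in> ?R"
        then obtain x y z where "w = h (add A (brk A x (brk A y z))
            (add A (brk A y (brk A z x)) (brk A z (brk A x y))))"
          and c: "x \<in> carr A" "y \<in> carr A" "z \<in> carr A"
          by blast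
        then have "w = add B (brk B (h x) (brk B (h y) (h z)))
          (add B (brk B (h y) (brk B (h z) (h x))) (brk B (h z) (brk B (h x) (h y))))"
          by (simp only: jac)
        then show "w \<in> ?L" using c by blast
      qed
    qed
  qed
qed

section \<open>Quotients by ideals\<close>

context bilinear_algebra
begin

context
  fixes I assumes ideal: "is_ideal A I"
begin

lemma ideal_facts:
  "I \<subseteq> carr A" "zer A \<in> I"
  "\<And>x y. \<lbrakk>x \<in> I; y \<in> I\<rbrakk> \<Longrightarrow> add A x y \<in> I" "\<And>c x. x \<in> I \<Longrightarrow> scl A c x \<in> I"
  "\<And>x y. \<lbrakk>x \<in> I; y \<in> carr A\<rbrakk> \<Longrightarrow> brk A x y \<in> I"
  "\<And>x y. \<lbrakk>x \<in> I; y \<in> carr A\<rbrakk> \<Longrightarrow> brk A y x \<in> I"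
  using ideal unfolding is_ideal_def lin_subspace_def by blast+

lemma ideal_carr: "i \<in> I \<Longrightarrow> i \<in> carr A"
  using ideal_facts(1) by blast

lemma coset_add_ideal:
  assumes "x \<in> carr A" "i \<in> I"
  shows "coset A I (add A x i) = coset A I x"
proof -
  have "add A (add A x i) j \<in> add A x ` I" if "j \<in> I" for j
  proof (rule image_eqI)
    show "add A (add A x i) j = add A x (add A i j)"
      using that assms ideal_carr by (simp add: add_assoc)
    show "add A i j \<in> I"
      using that assms(2) by (rule ideal_facts(3)[rotated])
  qed
  moreover have "add A x j \<in> add A (add A x i) ` I" if "j \<in> I" for j
  proof (rule image_eqI)
    have c: "i \<in> carr A" "j \<in> carr A" using that assms ideal_carr by auto
    have "add A i (add A (scl A (- 1) i) j) = j"
      using c by (simp add: add_assoc[symmetric] add_neg add_zer closed)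
    then show "add A x j = add A (add A x i) (add A (scl A (- 1) i) j)"
      using c assms by (simp add: add_assoc closed)
    show "add A (scl A (- 1) i) j \<in> I"
      using that assms(2) by (intro ideal_facts(3,4))
  qed
  ultimately show ?thesis
    unfolding coset_def by (intro equalityI image_subsetI)
qed

lemma in_coset_self: "x \<in> carr A \<Longrightarrow> x \<in> coset A I x"
  unfolding coset_def by (rule image_eqI[of _ _ "zer A"]) (simp_all add: add_zer_right ideal_facts(2))

lemma coset_eq_zer_iff:
  assumes "x \<in> carr A"
  shows "coset A I x = coset A I (zer A) \<longleftrightarrow> x \<in> I"
proof
  assume "coset A I x = coset A I (zer A)"
  then have "x \<in> coset A I (zer A)"
    using in_coset_self assms by blast
  then show "x \<in> I"
    using add_zer ideal_carr by (auto simp: coset_def)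
next
  assume "x \<in> I"
  then show "coset A I x = coset A I (zer A)"
    using coset_add_ideal[OF zer_closed] add_zer assms by metis
qed

text \<open>A change of representatives alters the sum by an element of \<open>I\<close>, so all
  members of the union in \<open>quot\<close> coincide; the union is nonempty because
  \<open>zer A \<in> I\<close>.\<close>

lemma quot_add:
  assumes "x \<in> carr A" "y \<in> carr A"
  shows "add (quot A I) (coset A I x) (coset A I y) = coset A I (add A x y)"
proof -
  have "coset A I (add A (add A x i) (add A y j)) = coset A I (add A x y)"
    if "i \<in> I" "j \<in> I" for i j
  proof -
    have "i \<in> carr A" "j \<in> carr A"
      using that ideal_carr by auto
    then have "add A (add A x i) (add A y j) = add A (add A x y) (add A i j)"
      using assms by (simp add: add_assoc add_left_commute closed)
    then show ?thesis
      using that assms ideal_facts by (simp add: coset_add_ideal closed)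
  qed
  then show ?thesis
    using ideal_facts(2) by (auto simp: quot_def coset_def[of A I x] coset_def[of A I y])
qed

lemma quot_scl:
  assumes "x \<in> carr A"
  shows "scl (quot A I) c (coset A I x) = coset A I (scl A c x)"
proof -
  have "coset A I (scl A c (add A x i)) = coset A I (scl A c x)" if "i \<in> I" for i
    using that assms ideal_carr ideal_facts by (simp add: scl_add_right coset_add_ideal closed)
  then show ?thesis
    using ideal_facts(2) by (auto simp: quot_def coset_def[of A I x])
qed

lemma quot_brk:
  assumes "x \<in> carr A" "y \<in> carr A"
  shows "brk (quot A I) (coset A I x) (coset A I y) = coset A I (brk A x y)"
proof -
  have "coset A I (brk A (add A x i) (add A y j)) = coset A I (brk A x y)"
    if "i \<in> I" "j \<in> I" for i j
  proof -
    have c: "i \<in> carr A" "j \<in> carr A"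
      using that ideal_carr by auto
    then have "brk A (add A x i) (add A y j) =
        add A (brk A x y) (add A (brk A x j) (add A (brk A i y) (brk A i j)))"
      using assms by (simp add: brk_add_left brk_add_right add_assoc add_left_commute closed)
    moreover have "add A (brk A x j) (add A (brk A i y) (brk A i j)) \<in> I"
      using that assms c ideal_facts by simp
    ultimately show ?thesis
      using assms by (simp add: coset_add_ideal closed)
  qed
  then show ?thesis
    using ideal_facts(2) by (auto simp: quot_def coset_def[of A I x] coset_def[of A I y])
qed

lemma carr_quot: "carr (quot A I) = coset A I ` carr A"
  and zer_quot: "zer (quot A I) = coset A I (zer A)"
  by (simp_all add: quot_def)

lemma coset_hom: "alg_hom A (quot A I) (coset A I)"
  by (simp add: alg_hom_def carr_quot quot_add quot_scl quot_brk)

lemma bilinear_algebra_quot: "bilinear_algebra (quot A I)"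
  using bilinear_algebra_image[OF _ coset_hom carr_quot zer_quot] bilinear_algebra_axioms .

text \<open>The universal property of the quotient: \<open>h\<close> is evaluated at a chosen
  representative, and the choice is immaterial because \<open>h\<close> vanishes on
  \<open>I\<close>.\<close>

lemma quot_hom_exists:
  assumes "bilinear_algebra B" "alg_hom A B h" "\<And>x. x \<in> I \<Longrightarrow> h x = zer B"
  shows "\<exists>h'. alg_hom (quot A I) B h' \<and> (\<forall>x\<in>carr A. h' (coset A I x) = h x)"
proof -
  interpret B: bilinear_algebra B by fact
  define h' where "h' X = h (SOME x. x \<in> X)" for X
  have h': "h' (coset A I x) = h x" if x: "x \<in> carr A" for x
  proof -
    have "(SOME y. y \<in> coset A I x) \<in> coset A I x"
      using in_coset_self[OF x] by (rule someI)
    then obtain i where i: "i \<in> I" "(SOME y. y \<in> coset A I x) = add A x i"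
      by (auto simp: coset_def)
    have "h (add A x i) = add B (h x) (zer B)"
      using assms(2,3) i x ideal_carr by (simp add: alg_hom_def)
    also have "\<dots> = h x"
      using assms(2) x by (simp add: alg_hom_def B.add_zer_right)
    finally show ?thesis
      by (simp add: h'_def i)
  qed
  have "alg_hom (quot A I) B h'"
    using assms(2)
    by (auto simp: alg_hom_def carr_quot h' quot_add quot_scl quot_brk closed)
  with h' show ?thesis by blast
qed

end

section \<open>The descending central series\<close>

lemma foldl_in_lcs:
  assumes "x \<in> carr A" "set xs \<subseteq> carr A"
  shows "foldl (brk A) x xs \<in> lcs A (Suc (length xs))"
  using assms(2)
proof (induction xs rule: rev_induct)
  case Nil
  then show ?case using assms by simp
next
  case (snoc y ys)
  then have "brk A (foldl (brk A) x ys) y \<in>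
      {brk A x y | x y. x \<in> lcs A (Suc (length ys)) \<and> y \<in> carr A}"
    by auto
  then have "brk A (foldl (brk A) x ys) y \<in> lcs A (Suc (Suc (length ys)))"
    unfolding lcs.simps(3) by (rule subsetD[OF span_superset])
  then show ?case by simp
qed

lemma lcs_subspace: "lin_subspace A (lcs A i)"
proof (cases i)
  case (Suc j)
  have "lin_subspace A (lcs A (Suc j))"
  proof (induction j)
    case (Suc j)
    then have "{brk A x y | x y. x \<in> lcs A (Suc j) \<and> y \<in> carr A} \<subseteq> carr A"
      by (auto simp: lin_subspace_def intro!: closed)
    then show ?case
      unfolding lcs.simps(3) by (rule span_subspace)
  qed (simp add: subspace_carr)
  then show ?thesis by (simp add: Suc)
qed (simp add: subspace_carr)

lemma lcs_carr: "x \<in> lcs A i \<Longrightarrow> x \<in> carr A"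
  using lcs_subspace[of i] unfolding lin_subspace_def by blast

lemma lcs_antimono: "lcs A (Suc (Suc i)) \<subseteq> lcs A (Suc i)"
proof (induction i)
  case 0
  then show ?case using lcs_carr[of _ "Suc (Suc 0)"] by (simp add: subset_iff del: lcs.simps(3))
next
  case (Suc i)
  show ?case
    unfolding lcs.simps(3)[of A "Suc i"] lcs.simps(3)[of A i]
    by (rule span_mono) (use Suc[unfolded lcs.simps(3)] in blast)
qed

text \<open>Polarization of the vanishing square of \<open>add A y x\<close>.\<close>

lemma brk_anticommute:
  assumes "lie_relators A \<subseteq> {zer A}" "x \<in> carr A" "y \<in> carr A"
  shows "brk A y x = scl A (- 1) (brk A x y)"
proof -
  have sq: "brk A z z = zer A" if "z \<in> carr A" for z
    using that assms(1) by (auto simp: lie_relators_def)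
  have "brk A (add A y x) (add A y x) = add A (brk A y x) (brk A x y)"
    using assms by (simp add: brk_add_left brk_add_right sq[OF assms(2)] sq[OF assms(3)]
      add_commute add_zer add_zer_right closed)
  then have "add A (brk A y x) (brk A x y) = zer A"
    using assms by (simp add: sq[OF add_closed])
  then have "add A (brk A y x) (scl A (- 1) (scl A (- 1) (brk A x y))) = zer A"
    using assms by (simp add: scl_scl scl_one closed)
  then show ?thesis
    using assms by (simp add: eq_of_diff_zer closed)
qed

text \<open>The series is built from brackets with \<open>carr A\<close> on the right;
  anticommutativity supplies those on the left.\<close>

lemma lcs_ideal:
  assumes "lie_relators A \<subseteq> {zer A}"
  shows "is_ideal A (lcs A (Suc i))"
  unfolding is_ideal_def
proof (intro conjI ballI lcs_subspace)
  fix x y assume xy: "x \<in> lcs A (Suc i)" "y \<in> carr A"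
  have "brk A x y \<in> lcs A (Suc (Suc i))"
    unfolding lcs.simps(3) by (rule subsetD[OF span_superset]) (use xy in blast)
  then show *: "brk A x y \<in> lcs A (Suc i)"
    using lcs_antimono by blast
  show "brk A y x \<in> lcs A (Suc i)"
    using * lcs_subspace[of "Suc i"] brk_anticommute[OF assms lcs_carr[OF xy(1)] xy(2)]
    by (simp add: lin_subspace_def)
qed

lemma subspace_vimage:
  assumes "bilinear_algebra B" "alg_hom A B h" "lin_subspace B W"
  shows "lin_subspace A {x \<in> carr A. h x \<in> W}"
  using assms alg_hom_zer[OF bilinear_algebra_axioms assms(1,2)]
  by (simp add: lin_subspace_def alg_hom_def closed)

lemma ideal_vimage_zer:
  assumes "bilinear_algebra B" "alg_hom A B h"
  shows "is_ideal A {x \<in> carr A. h x = zer B}"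
proof -
  interpret B: bilinear_algebra B by fact
  have "lin_subspace B {zer B}"
    by (simp add: lin_subspace_def B.closed B.add_zer B.scl_zer)
  from subspace_vimage[OF assms this] show ?thesis
    using assms(2) by (simp add: is_ideal_def alg_hom_def closed B.brk_zer_left B.brk_zer_right)
qed

lemma hom_lcs:
  assumes "bilinear_algebra B" "alg_hom A B h" "x \<in> lcs A (Suc i)"
  shows "h x \<in> lcs B (Suc i)"
  using assms(3)
proof (induction i arbitrary: x)
  case 0
  then show ?case using assms(2) by (simp add: alg_hom_def)
next
  case (Suc i)
  interpret B: bilinear_algebra B by fact
  \<comment> \<open>The preimage of the next term of the series of \<open>B\<close> is a subspace,
    so it contains the span once it contains the generating brackets.\<close>
  let ?W = "{x \<in> carr A. h x \<in> lcs B (Suc (Suc i))}"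
  have "lin_span A {brk A x y | x y. x \<in> lcs A (Suc i) \<and> y \<in> carr A} \<subseteq> ?W"
  proof (rule span_minimal[OF subspace_vimage[OF assms(1,2) B.lcs_subspace]])
    have "h (brk A x y) \<in> lcs B (Suc (Suc i))" if "x \<in> lcs A (Suc i)" "y \<in> carr A" for x y
    proof -
      have "brk B (h x) (h y) \<in> {brk B x y | x y. x \<in> lcs B (Suc i) \<and> y \<in> carr B}"
        using Suc.IH[OF that(1)] that(2) assms(2) by (auto simp: alg_hom_def)
      then have "brk B (h x) (h y) \<in> lcs B (Suc (Suc i))"
        unfolding lcs.simps(3) by (rule subsetD[OF span_superset])
      then show ?thesis
        using assms(2) that lcs_carr by (simp add: alg_hom_def)
    qed
    then show "{brk A x y | x y. x \<in> lcs A (Suc i) \<and> y \<in> carr A} \<subseteq> ?W"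
      using lcs_carr by (auto intro: closed)
  qed
  then show ?case using Suc.prems by auto
qed

end

section \<open>The free nilpotent Lie algebra\<close>

lemma lookup_map_scale:
  "Poly_Mapping.lookup (Poly_Mapping.map ((*) c) p) t = (c :: 'k :: field) * Poly_Mapping.lookup p t"
  by (simp add: Poly_Mapping.map.rep_eq when_def)

lemma keys_map_scale: "Poly_Mapping.keys (Poly_Mapping.map ((*) (c::'k::field)) p) \<subseteq> Poly_Mapping.keys p"
  by (auto simp: in_keys_iff lookup_map_scale)

lemma magma_brk_superset:
  assumes "finite S" "finite T" "Poly_Mapping.keys p \<subseteq> S" "Poly_Mapping.keys q \<subseteq> T"
  shows "magma_brk p q = (\<Sum>s\<in>S. \<Sum>t\<in>T.
     Poly_Mapping.single (Mul s t) (Poly_Mapping.lookup p s * Poly_Mapping.lookup q t))"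
proof -
  have "magma_brk p q = (\<Sum>s\<in>Poly_Mapping.keys p. \<Sum>t\<in>T.
     Poly_Mapping.single (Mul s t) (Poly_Mapping.lookup p s * Poly_Mapping.lookup q t))"
    unfolding magma_brk_def
    by (intro sum.cong refl sum.mono_neutral_left assms) (auto simp: in_keys_iff)
  also have "\<dots> = (\<Sum>s\<in>S. \<Sum>t\<in>T.
     Poly_Mapping.single (Mul s t) (Poly_Mapping.lookup p s * Poly_Mapping.lookup q t))"
    by (intro sum.mono_neutral_left assms) (auto simp: in_keys_iff)
  finally show ?thesis .
qed

text \<open>\<open>Mul\<close> is injective, so each tree receives exactly one contribution. With
  this formula the algebra axioms can be verified coefficient by coefficient.\<close>

lemma lookup_magma_brk:
  "Poly_Mapping.lookup (magma_brk p q) u =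
    (case u of Gen i \<Rightarrow> 0 | Mul s t \<Rightarrow> Poly_Mapping.lookup p s * Poly_Mapping.lookup q t)"
proof (cases u)
  case (Gen i)
  then show ?thesis
    by (simp add: magma_brk_def lookup_sum lookup_single)
next
  case (Mul s' t')
  \<comment> \<open>Adding \<open>s'\<close> and \<open>t'\<close> to the supports lets both sums
    collapse to these indices even if their coefficients are zero.\<close>
  let ?S = "insert s' (Poly_Mapping.keys p)" and ?T = "insert t' (Poly_Mapping.keys q)"
  have "Poly_Mapping.lookup (magma_brk p q) u = (\<Sum>s\<in>?S. \<Sum>t\<in>?T.
     if s = s' \<and> t = t' then Poly_Mapping.lookup p s * Poly_Mapping.lookup q t else 0)"
    by (subst magma_brk_superset[of ?S ?T])
      (auto simp: Mul lookup_sum lookup_single when_def intro!: sum.cong)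
  also have "\<dots> = (\<Sum>s\<in>?S. if s = s' then \<Sum>t\<in>?T.
     if t = t' then Poly_Mapping.lookup p s * Poly_Mapping.lookup q t else 0 else 0)"
    by (intro sum.cong) auto
  also have "\<dots> = Poly_Mapping.lookup p s' * Poly_Mapping.lookup q t'"
    by (simp only: sum.delta finite.insertI finite_keys insertI1 if_True)
  finally show ?thesis by (simp add: Mul)
qed

lemma bilinear_algebra_magma_alg: "bilinear_algebra (magma_alg m :: ('k::field, _) balg)"
proof -
  have scl: "Poly_Mapping.map ((*) c) p \<in> carr (magma_alg m)"
    if "p \<in> carr (magma_alg m)" for p :: "magma \<Rightarrow>\<^sub>0 'k" and c
    using that keys_map_scale[of c p] by (auto simp: magma_alg_def)
  have add: "p + q \<in> carr (magma_alg m)"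
    if "p \<in> carr (magma_alg m)" "q \<in> carr (magma_alg m)" for p q :: "magma \<Rightarrow>\<^sub>0 'k"
    using that keys_add[of p q] by (simp add: magma_alg_def) blast
  have brk: "magma_brk p q \<in> carr (magma_alg m)"
    if "p \<in> carr (magma_alg m)" "q \<in> carr (magma_alg m)" for p q :: "magma \<Rightarrow>\<^sub>0 'k"
  proof -
    have "gens t \<subseteq> {..<m}" if "t \<in> Poly_Mapping.keys (magma_brk p q)" for t
      using that \<open>p \<in> _\<close> \<open>q \<in> _\<close>
      by (cases t) (simp_all add: in_keys_iff lookup_magma_brk magma_alg_def)
    then show ?thesis by (simp add: magma_alg_def)
  qed
  have simps: "balg.zer (magma_alg m) = (0 :: magma \<Rightarrow>\<^sub>0 'k)" "balg.add (magma_alg m) p q = p + q"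
    "balg.scl (magma_alg m) c p = Poly_Mapping.map ((*) c) p"
    "balg.brk (magma_alg m) p q = magma_brk p q" for p q :: "magma \<Rightarrow>\<^sub>0 'k" and c
    by (simp_all add: magma_alg_def)
  have zer: "(0 :: magma \<Rightarrow>\<^sub>0 'k) \<in> carr (magma_alg m)"
    by (simp add: magma_alg_def)
  show ?thesis
    by (unfold_locales; (simp only: simps scl add brk zer)?;
      rule poly_mapping_eqI, simp add: lookup_map_scale lookup_add lookup_magma_brk algebra_simps
        split: magma.split)
qed

text \<open>The relators of the quotient are images of relators of the magma algebra, which lie in
  the ideal divided out.\<close>

lemma lie_relators_free_lie: "lie_relators (free_lie m :: ('k::field, _) balg) \<subseteq> {zer (free_lie m)}"
  and bilinear_algebra_free_lie: "bilinear_algebra (free_lie m :: ('k, _) balg)"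
proof -
  let ?A = "magma_alg m :: ('k, _) balg"
  interpret bilinear_algebra ?A by (rule bilinear_algebra_magma_alg)
  note I = ideal_gen_is_ideal[OF lie_relators_closed]
  show "lie_relators (free_lie m :: ('k, _) balg) \<subseteq> {zer (free_lie m)}"
  proof -
    have "coset ?A (ideal_gen ?A (lie_relators ?A)) x = zer (free_lie m)"
      if "x \<in> lie_relators ?A" for x
      unfolding free_lie_def zer_quot[OF I]
      using that lie_relators_closed by (subst coset_eq_zer_iff[OF I]) (auto simp: ideal_gen_def)
    then show ?thesis
      unfolding free_lie_def
        lie_relators_image[OF bilinear_algebra_axioms coset_hom[OF I] carr_quot[OF I]]
      by auto
  qed
  show "bilinear_algebra (free_lie m :: ('k, _) balg)"
    unfolding free_lie_def by (rule bilinear_algebra_quot[OF I])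
qed

text \<open>\<open>free_nilp\<close> is a quotient of a quotient, whence the two coset maps; the
  images of the trees \<open>Gen i\<close> with \<open>i < m\<close> are the free
  generators.\<close>

definition free_nilp_proj :: "nat \<Rightarrow> nat \<Rightarrow> (magma \<Rightarrow>\<^sub>0 'k::field) \<Rightarrow> (magma \<Rightarrow>\<^sub>0 'k) set set" where
  "free_nilp_proj k m =
    coset (free_lie m) (lcs (free_lie m) (k + 1)) \<circ>
    coset (magma_alg m) (ideal_gen (magma_alg m) (lie_relators (magma_alg m)))"

text \<open>Everything is pulled back to \<open>free_lie m\<close> along the quotient map. In
  particular \<open>k\<close> successive brackets of lifts land in the term \<open>k + 1\<close> of
  the series, which is divided out.\<close>

lemma bilinear_algebra_free_nilp: "bilinear_algebra (free_nilp k m :: ('k::field, _) balg)"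
  and lie_relators_free_nilp:
    "lie_relators (free_nilp k m :: ('k, _) balg) \<subseteq> {zer (free_nilp k m)}"
  and foldl_free_nilp: "\<lbrakk>x \<in> carr (free_nilp k m :: ('k, _) balg); set xs \<subseteq> carr (free_nilp k m);
    length xs = k\<rbrakk> \<Longrightarrow> foldl (brk (free_nilp k m)) x xs = zer (free_nilp k m)"
  and free_nilp_proj_closed: "p \<in> carr (magma_alg m :: ('k, _) balg) \<Longrightarrow>
    free_nilp_proj k m p \<in> carr (free_nilp k m)"
proof -
  let ?M = "magma_alg m :: ('k, _) balg"
  let ?L = "free_lie m :: ('k, _) balg"
  interpret M: bilinear_algebra ?M by (rule bilinear_algebra_magma_alg)
  interpret L: bilinear_algebra ?L by (rule bilinear_algebra_free_lie)
  note J = M.ideal_gen_is_ideal[OF M.lie_relators_closed]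
  have I: "is_ideal ?L (lcs ?L (k + 1))"
    using L.lcs_ideal[OF lie_relators_free_lie] by simp
  let ?q = "coset ?L (lcs ?L (k + 1))"
  show N: "bilinear_algebra (free_nilp k m :: ('k, _) balg)"
    unfolding free_nilp_def by (rule L.bilinear_algebra_quot[OF I])
  have q: "alg_hom ?L (free_nilp k m) ?q" and surj: "carr (free_nilp k m) = ?q ` carr ?L"
    and zer: "zer (free_nilp k m) = ?q (zer ?L)"
    unfolding free_nilp_def by (rule L.coset_hom[OF I] L.carr_quot[OF I] L.zer_quot[OF I])+
  show "lie_relators (free_nilp k m :: ('k, _) balg) \<subseteq> {zer (free_nilp k m)}"
    using lie_relators_image[OF L.bilinear_algebra_axioms q surj]
      lie_relators_free_lie[where 'k = 'k, of m] zer by auto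
  show "foldl (brk (free_nilp k m)) x xs = zer (free_nilp k m)"
    if x: "x \<in> carr (free_nilp k m :: ('k, _) balg)" and xs: "set xs \<subseteq> carr (free_nilp k m)"
      "length xs = k"
    for x xs
  proof -
    obtain y where y: "y \<in> carr ?L" "x = ?q y"
      using x unfolding surj by blast
    have "xs \<in> map ?q ` lists (carr ?L)"
      using xs(1) unfolding surj lists_image[symmetric] by blast
    then obtain ys where ys: "set ys \<subseteq> carr ?L" "xs = map ?q ys"
      by (auto simp: lists_eq_set)
    have "foldl (brk ?L) y ys \<in> lcs ?L (k + 1)"
      using L.foldl_in_lcs[OF y(1) ys(1)] ys(2) xs(2) by simp
    then have "?q (foldl (brk ?L) y ys) = zer (free_nilp k m)"
      using zer L.coset_eq_zer_iff[OF I] L.lcs_carr by metis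
    then show ?thesis
      using alg_hom_foldl[OF L.bilinear_algebra_axioms q y(1) ys(1)] y ys by simp
  qed
  let ?p = "coset ?M (ideal_gen ?M (lie_relators ?M))"
  have p: "alg_hom ?M ?L ?p"
    unfolding free_lie_def by (rule M.coset_hom[OF J])
  show "free_nilp_proj k m p \<in> carr (free_nilp k m)" if "p \<in> carr ?M" for p
    using alg_hom_comp[OF p q] that unfolding free_nilp_proj_def by (simp add: alg_hom_def)
qed

text \<open>The universal property of the free nilpotent algebra: a map to a Lie algebra with
  vanishing term \<open>k + 1\<close> factors through both quotients.\<close>

lemma free_nilp_lift:
  fixes B :: "('k::field, 'b) balg"
  assumes B: "bilinear_algebra B" "lie_relators B \<subseteq> {zer B}" "lcs B (k + 1) \<subseteq> {zer B}"
    and h: "alg_hom (magma_alg m) B h"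
  obtains h' where "alg_hom (free_nilp k m) B h'"
    "\<And>p. p \<in> carr (magma_alg m) \<Longrightarrow> h' (free_nilp_proj k m p) = h p"
proof -
  let ?M = "magma_alg m :: ('k, _) balg"
  let ?L = "free_lie m :: ('k, _) balg"
  interpret M: bilinear_algebra ?M by (rule bilinear_algebra_magma_alg)
  interpret L: bilinear_algebra ?L by (rule bilinear_algebra_free_lie)
  note J = M.ideal_gen_is_ideal[OF M.lie_relators_closed]
  have I: "is_ideal ?L (lcs ?L (k + 1))"
    using L.lcs_ideal[OF lie_relators_free_lie] by simp
  let ?q = "coset ?L (lcs ?L (k + 1))"
  let ?p = "coset ?M (ideal_gen ?M (lie_relators ?M))"
  have p: "?p x \<in> carr ?L" if "x \<in> carr ?M" for x
    using M.coset_hom[OF J] that unfolding free_lie_def by (simp add: alg_hom_def)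
  have "lie_relators ?M \<subseteq> {x \<in> carr ?M. h x = zer B}"
  proof
    fix x assume x: "x \<in> lie_relators ?M"
    have "h x = zer B"
    proof -
      have sq: "brk B u u = zer B" if "u \<in> carr B" for u
        using B(2) that by (auto simp: lie_relators_def)
      have jac: "add B (brk B u (brk B v w)) (add B (brk B v (brk B w u)) (brk B w (brk B u v))) = zer B"
        if "u \<in> carr B" "v \<in> carr B" "w \<in> carr B" for u v w
        using B(2) that unfolding lie_relators_def by blast
      have h': "h u \<in> carr B" "h (add ?M u v) = add B (h u) (h v)" "h (brk ?M u v) = brk B (h u) (h v)"
        if "u \<in> carr ?M" "v \<in> carr ?M" for u v
        using h that by (simp_all add: alg_hom_def)
      from x consider u where "u \<in> carr ?M" "x = brk ?M u u"
        | u v w where "u \<in> carr ?M" "v \<in> carr ?M" "w \<in> carr ?M"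
          "x = add ?M (brk ?M u (brk ?M v w)) (add ?M (brk ?M v (brk ?M w u)) (brk ?M w (brk ?M u v)))"
        unfolding lie_relators_def by blast
      then show ?thesis
        by cases (simp_all add: h' sq jac M.closed)
    qed
    then show "x \<in> {x \<in> carr ?M. h x = zer B}"
      using x M.lie_relators_closed by auto
  qed
  \<comment> \<open>The kernel of \<open>h\<close> is an ideal containing the relators.\<close>
  then have "ideal_gen ?M (lie_relators ?M) \<subseteq> {x \<in> carr ?M. h x = zer B}"
    unfolding ideal_gen_def using M.ideal_vimage_zer[OF B(1) h] by blast
  then have "h x = zer B" if "x \<in> ideal_gen ?M (lie_relators ?M)" for x
    using that by auto
  from M.quot_hom_exists[OF J B(1) h this]
  obtain h1 where h1: "alg_hom ?L B h1" "\<forall>x\<in>carr ?M. h1 (?p x) = h x"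
    unfolding free_lie_def by auto
  have "h1 x = zer B" if "x \<in> lcs ?L (k + 1)" for x
    using L.hom_lcs[OF B(1) h1(1), of x k] that B(3) by auto
  from L.quot_hom_exists[OF I B(1) h1(1) this]
  obtain h2 where h2: "alg_hom (free_nilp k m) B h2" "\<forall>x\<in>carr ?L. h2 (?q x) = h1 x"
    unfolding free_nilp_def by auto
  show ?thesis
  proof
    show "h2 (free_nilp_proj k m x) = h x" if "x \<in> carr ?M" for x
      using that p h1(2) h2(2) by (simp add: free_nilp_proj_def)
  qed (rule h2(1))
qed

section \<open>Homomorphisms to the filiform Lie algebra\<close>

text \<open>Coordinate \<open>0\<close> belongs to an element \<open>x\<close> and coordinate \<open>i \<ge> 1\<close> to \<open>e\<^sub>i\<close>, with
  \<open>[x, e\<^sub>i] = e\<^sub>i\<^sub>+\<^sub>1\<close> for \<open>i < k\<close>. The coordinates above \<open>k\<close> span an abelian summand, kept only so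
  that the carrier is a type.\<close>

definition filiform_brk :: "nat \<Rightarrow> (nat \<Rightarrow> 'k::field) \<Rightarrow> (nat \<Rightarrow> 'k) \<Rightarrow> nat \<Rightarrow> 'k" where
  "filiform_brk k v w = (\<lambda>i. if 2 \<le> i \<and> i \<le> k then v 0 * w (i - 1) - w 0 * v (i - 1) else 0)"

definition filiform :: "nat \<Rightarrow> ('k::field, nat \<Rightarrow> 'k) balg" where
  "filiform k = \<lparr> carr = UNIV, zer = (\<lambda>i. 0), add = (\<lambda>v w i. v i + w i), scl = (\<lambda>c v i. c * v i),
     brk = filiform_brk k \<rparr>"

lemma bilinear_algebra_filiform: "bilinear_algebra (filiform k)"
  by unfold_locales (simp_all add: filiform_def filiform_brk_def fun_eq_iff algebra_simps)

lemma lie_relators_filiform: "lie_relators (filiform k) \<subseteq> {zer (filiform k)}"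
  by (auto simp: lie_relators_def filiform_def filiform_brk_def fun_eq_iff algebra_simps)

text \<open>Each bracket raises the lowest possible index by one, so the term \<open>i + 2\<close>
  of the series lies in the span of \<open>e\<^sub>j\<close> for
  \<open>i + 2 \<le> j \<le> k\<close>.\<close>

lemma lcs_filiform:
  "v \<in> lcs (filiform k) (Suc (Suc i)) \<Longrightarrow> j < i + 2 \<or> j > k \<Longrightarrow> v j = 0"
proof (induction i arbitrary: v j)
  case (0 v j)
  let ?W = "{v. \<forall>j. j < 2 \<or> j > k \<longrightarrow> v j = 0} :: (nat \<Rightarrow> 'a) set"
  have "lin_span (filiform k) {brk (filiform k) x y | x y. x \<in> lcs (filiform k) (Suc 0) \<and>
      y \<in> carr (filiform k)} \<subseteq> ?W"
    by (rule span_minimal) (auto simp: lin_subspace_def filiform_def filiform_brk_def)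
  then show ?case
    using 0 by auto
next
  case (Suc i v j)
  let ?W = "{v. \<forall>j. j < i + 3 \<or> j > k \<longrightarrow> v j = 0} :: (nat \<Rightarrow> 'a) set"
  have "brk (filiform k) x y \<in> ?W" if x: "x \<in> lcs (filiform k) (Suc (Suc i))" for x y
  proof -
    \<comment> \<open>The first fact removes the summand with \<open>x 0\<close>, the second the one
      with \<open>x (j - 1)\<close>.\<close>
    have "x 0 = 0" "\<And>j. j < i + 3 \<Longrightarrow> x (j - 1) = 0"
      by (rule Suc.IH[OF x]; simp; linarith)+
    then show ?thesis
      by (simp add: filiform_def filiform_brk_def)
  qed
  then have "lin_span (filiform k) {brk (filiform k) x y | x y. x \<in> lcs (filiform k) (Suc (Suc i)) \<and>
      y \<in> carr (filiform k)} \<subseteq> ?W"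
    by (intro span_minimal) (auto simp: lin_subspace_def filiform_def)
  then have "v \<in> ?W"
    using Suc.prems(1) unfolding lcs.simps(3)[of _ "Suc i"] by blast
  then show ?case
    using Suc.prems(2) by auto
qed

lemma lcs_filiform_zer:
  assumes "k \<ge> 1"
  shows "lcs (filiform k :: ('k::field, _) balg) (k + 1) \<subseteq> {zer (filiform k)}"
proof
  fix v :: "nat \<Rightarrow> 'k" assume v: "v \<in> lcs (filiform k) (k + 1)"
  \<comment> \<open>For \<open>i = k - 1\<close> the conditions \<open>j < k + 1\<close> and
    \<open>j > k\<close> of \<open>lcs_filiform\<close> exhaust all coordinates.\<close>
  have k: "k + 1 = Suc (Suc (k - 1))"
    using assms by simp
  have "v j = 0" for j
    by (rule lcs_filiform[of v k "k - 1"]) (use v k in auto)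
  then show "v \<in> {zer (filiform k)}"
    by (simp add: filiform_def fun_eq_iff)
qed

section \<open>Evaluation homomorphisms into the filiform algebra\<close>

fun magma_eval :: "nat \<Rightarrow> (nat \<Rightarrow> nat \<Rightarrow> 'k::field) \<Rightarrow> magma \<Rightarrow> nat \<Rightarrow> 'k" where
  "magma_eval k a (Gen i) = a i"
| "magma_eval k a (Mul s t) = filiform_brk k (magma_eval k a s) (magma_eval k a t)"

text \<open>The linear extension of \<open>magma_eval\<close>, that is, the homomorphism sending the
  generator \<open>i\<close> to \<open>a i\<close>.\<close>

definition magma_lin :: "nat \<Rightarrow> (nat \<Rightarrow> nat \<Rightarrow> 'k::field) \<Rightarrow> (magma \<Rightarrow>\<^sub>0 'k) \<Rightarrow> nat \<Rightarrow> 'k" where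
  "magma_lin k a p = (\<lambda>j. \<Sum>s\<in>Poly_Mapping.keys p. Poly_Mapping.lookup p s * magma_eval k a s j)"

lemma magma_lin_superset:
  "\<lbrakk>finite S; Poly_Mapping.keys p \<subseteq> S\<rbrakk> \<Longrightarrow>
    magma_lin k a p j = (\<Sum>s\<in>S. Poly_Mapping.lookup p s * magma_eval k a s j)"
  unfolding magma_lin_def by (rule sum.mono_neutral_left) (auto simp: in_keys_iff)

lemma magma_lin_add: "magma_lin k a (p + q) j = magma_lin k a p j + magma_lin k a q j"
proof -
  let ?S = "Poly_Mapping.keys p \<union> Poly_Mapping.keys q"
  have "magma_lin k a r j = (\<Sum>s\<in>?S. Poly_Mapping.lookup r s * magma_eval k a s j)"
    if "r \<in> {p, q, p + q}" for r
    using that keys_add[of p q] by (intro magma_lin_superset) auto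
  then show ?thesis
    by (simp add: lookup_add algebra_simps sum.distrib)
qed

lemma magma_lin_scale:
  "magma_lin k a (Poly_Mapping.map ((*) c) p) j = c * magma_lin k a p j"
proof -
  have "magma_lin k a (Poly_Mapping.map ((*) c) p) j =
      (\<Sum>s\<in>Poly_Mapping.keys p. c * Poly_Mapping.lookup p s * magma_eval k a s j)"
    by (subst magma_lin_superset[OF finite_keys keys_map_scale]) (simp add: lookup_map_scale)
  then show ?thesis
    by (simp add: magma_lin_def sum_distrib_left mult.assoc)
qed

lemma magma_lin_single: "magma_lin k a (Poly_Mapping.single s c) j = c * magma_eval k a s j"
  by (cases "c = 0") (simp_all add: magma_lin_def)

lemma magma_lin_sum: "magma_lin k a (\<Sum>i\<in>I. p i) j = (\<Sum>i\<in>I. magma_lin k a (p i) j)"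
proof (induction I rule: infinite_finite_induct)
qed (simp_all add: magma_lin_add, simp_all add: magma_lin_def)

text \<open>Both sides are bilinear in \<open>p\<close> and \<open>q\<close>, and on trees they
  agree by the recursion for \<open>magma_eval\<close>.\<close>

lemma magma_lin_brk:
  "magma_lin k a (magma_brk p q) = filiform_brk k (magma_lin k a p) (magma_lin k a q)"
proof
  fix j
  let ?P = "Poly_Mapping.keys p" and ?Q = "Poly_Mapping.keys q"
  let ?p = "Poly_Mapping.lookup p" and ?q = "Poly_Mapping.lookup q"
  let ?e = "magma_eval k a"
  have prod: "magma_lin k a p i * magma_lin k a q i' =
      (\<Sum>s\<in>?P. \<Sum>t\<in>?Q. ?p s * ?e s i * (?q t * ?e t i'))" for i i'
    by (simp add: magma_lin_def sum_product)
  have "magma_lin k a (magma_brk p q) j =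
      (\<Sum>s\<in>?P. \<Sum>t\<in>?Q. ?p s * ?q t * filiform_brk k (?e s) (?e t) j)"
    by (simp add: magma_brk_def magma_lin_sum magma_lin_single)
  also have "\<dots> = filiform_brk k (magma_lin k a p) (magma_lin k a q) j"
  proof (cases "2 \<le> j \<and> j \<le> k")
    case True
    then have "(\<Sum>s\<in>?P. \<Sum>t\<in>?Q. ?p s * ?q t * filiform_brk k (?e s) (?e t) j) =
        (\<Sum>s\<in>?P. \<Sum>t\<in>?Q. ?p s * ?e s 0 * (?q t * ?e t (j - 1)) -
          ?p s * ?e s (j - 1) * (?q t * ?e t 0))"
      by (simp add: filiform_brk_def algebra_simps)
    also have "\<dots> = magma_lin k a p 0 * magma_lin k a q (j - 1) -
        magma_lin k a p (j - 1) * magma_lin k a q 0"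
      by (simp only: prod sum_subtractf)
    finally show ?thesis
      using True by (simp add: filiform_brk_def mult.commute)
  next
    case False
    then show ?thesis
      by (auto simp: filiform_brk_def)
  qed
  finally show "magma_lin k a (magma_brk p q) j = \<dots>" .
qed

lemma magma_lin_hom: "alg_hom (magma_alg m) (filiform k) (magma_lin k a)"
  by (simp add: alg_hom_def magma_alg_def filiform_def magma_lin_add magma_lin_scale magma_lin_brk
      fun_eq_iff)

section \<open>The free nilpotent algebra in coordinates\<close>

lemma coord_alg_simps [simp]:
  "carr (coord_alg \<mu>) = UNIV" "zer (coord_alg \<mu>) = 0" "add (coord_alg \<mu>) = (+)"
  "scl (coord_alg \<mu>) = (*s)" "brk (coord_alg \<mu>) = \<mu>"
  by (simp_all add: coord_alg_def)

lemma lie_bracketI: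
  assumes "bilinear_algebra (coord_alg \<mu>)" "lie_relators (coord_alg \<mu>) \<subseteq> {0}"
  shows "lie_bracket \<mu>"
proof -
  interpret bilinear_algebra "coord_alg \<mu>" by fact
  have "\<mu> x x = 0" for x
    using assms(2) by (auto simp: lie_relators_def)
  moreover have "\<mu> x (\<mu> y z) + \<mu> y (\<mu> z x) + \<mu> z (\<mu> x y) = 0" for x y z
  proof -
    have "\<mu> x (\<mu> y z) + (\<mu> y (\<mu> z x) + \<mu> z (\<mu> x y)) \<in> lie_relators (coord_alg \<mu>)"
      unfolding lie_relators_def by auto
    then show ?thesis
      using assms(2) by (auto simp: add.assoc)
  qed
  ultimately show ?thesis
    using brk_add_left brk_add_right brk_scl_left brk_scl_right
    by (simp add: lie_bracket_def Vector_Spaces.linear_iff vec.vector_space_axioms)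
qed

text \<open>All that the theorem takes from the isomorphism: the algebra axioms,
  \<open>k\<close>-step nilpotency, and generators \<open>X i\<close> whose images in the filiform
  algebra can be prescribed at will.\<close>

lemma free_nilp_coords:
  fixes \<mu> :: "('k::field, 'n::finite) bracket"
  assumes iso: "balg_iso (coord_alg \<mu>) (free_nilp k m)" and k: "k \<ge> 1"
  shows "bilinear_algebra (coord_alg \<mu>)" and "\<mu> \<in> nilp_brackets k"
    and "\<exists>X. \<forall>a. \<exists>\<Phi>. alg_hom (coord_alg \<mu>) (filiform k) \<Phi> \<and> (\<forall>i<m. \<Phi> (X i) = a i)"
proof -
  let ?N = "free_nilp k m :: ('k, _) balg"
  obtain f where bij: "bij_betw f UNIV (carr ?N)" and f: "alg_hom (coord_alg \<mu>) ?N f"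
    using iso by (auto simp: balg_iso_def alg_hom_def bij_betw_def)
  interpret N: bilinear_algebra ?N by (rule bilinear_algebra_free_nilp)
  define g where "g = inv_into UNIV f"
  have gf: "g (f x) = x" for x
    using bij by (simp add: g_def bij_betw_def)
  have fg: "f (g y) = y" if "y \<in> carr ?N" for y
    using bij that by (simp add: g_def bij_betw_inv_into_right)
  have fN: "f x \<in> carr ?N" for x
    using f by (simp add: alg_hom_def)
  have surj: "carr (coord_alg \<mu>) = g ` carr ?N"
    using gf fN by (auto simp: image_iff) (metis gf fN)
  have g: "alg_hom ?N (coord_alg \<mu>) g"
    using f by (simp add: alg_hom_def) (metis gf fg)
  \<comment> \<open>\<open>alg_hom_zer\<close> would require the axioms for
    \<open>coord_alg \<mu>\<close>, which are only derived from this fact.\<close>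
  have zer: "g (zer ?N) = 0"
  proof -
    have "g (zer ?N) = g (scl ?N 0 (zer ?N))"
      by (simp add: N.scl_zer)
    also have "\<dots> = 0 *s g (zer ?N)"
      using g N.zer_closed by (simp add: alg_hom_def)
    finally show ?thesis by simp
  qed
  show bil: "bilinear_algebra (coord_alg \<mu>)"
    using bilinear_algebra_image[OF bilinear_algebra_free_nilp g surj] zer by simp
  have "lie_relators (coord_alg \<mu>) \<subseteq> {0}"
    using lie_relators_image[OF bilinear_algebra_free_nilp g surj]
      lie_relators_free_nilp[where 'k = 'k, of k m] zer by auto
  then have "lie_bracket \<mu>"
    by (rule lie_bracketI[OF bil])
  moreover have "foldl \<mu> x xs = 0" if "length xs = k" for x xs
  proof -
    have "f (foldl \<mu> x xs) = foldl (brk ?N) (f x) (map f xs)"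
      using alg_hom_foldl[OF bil f] by simp
    also have "\<dots> = zer ?N"
      using fN that by (intro foldl_free_nilp) auto
    finally show ?thesis
      using gf zer by metis
  qed
  ultimately show "\<mu> \<in> nilp_brackets k"
    by (simp add: nilp_brackets_def)
  define X where "X i = g (free_nilp_proj k m (Poly_Mapping.single (Gen i) 1))" for i
  have "\<exists>\<Phi>. alg_hom (coord_alg \<mu>) (filiform k) \<Phi> \<and> (\<forall>i<m. \<Phi> (X i) = a i)" for a
  proof -
    obtain h where h: "alg_hom ?N (filiform k) h"
      "\<And>p. p \<in> carr (magma_alg m) \<Longrightarrow> h (free_nilp_proj k m p) = magma_lin k a p"
      using free_nilp_lift[OF bilinear_algebra_filiform lie_relators_filiform lcs_filiform_zer[OF k]
          magma_lin_hom[of m k a]] by blast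
    have "(h \<circ> f) (X i) = a i" if "i < m" for i
    proof -
      have i: "Poly_Mapping.single (Gen i) 1 \<in> carr (magma_alg m :: ('k, _) balg)"
        using that by (simp add: magma_alg_def)
      then have "(h \<circ> f) (X i) = magma_lin k a (Poly_Mapping.single (Gen i) 1)"
        using h(2)[OF i] fg[OF free_nilp_proj_closed[OF i]] by (simp add: X_def)
      then show ?thesis
        by (simp add: fun_eq_iff magma_lin_single)
    qed
    then show ?thesis
      using alg_hom_comp[OF f h(1)] by blast
  qed
  then show "\<exists>X. \<forall>a. \<exists>\<Phi>. alg_hom (coord_alg \<mu>) (filiform k) \<Phi> \<and> (\<forall>i<m. \<Phi> (X i) = a i)"
    by blast
qed

section \<open>Iterated brackets in the filiform algebra\<close>

definition unit_fun :: "nat \<Rightarrow> nat \<Rightarrow> 'k::field" where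
  "unit_fun i = (\<lambda>j. if j = i then 1 else 0)"

text \<open>Bracketing with \<open>x\<close> on the right moves \<open>e\<^sub>i\<close> to
  \<open>- e\<^sub>i\<^sub>+\<^sub>1\<close>, which explains the sign; \<open>j < k\<close> keeps
  the ladder from running past \<open>e\<^sub>k\<close>.\<close>

lemma filiform_ladder:
  "j < k \<Longrightarrow> foldl (filiform_brk k) (unit_fun 1) (replicate j (unit_fun 0)) =
    (\<lambda>i. if i = j + 1 then (- 1) ^ j else 0 :: 'k::field)"
proof (induction j)
  case 0
  then show ?case by (simp add: unit_fun_def fun_eq_iff)
next
  case (Suc j)
  have "foldl (filiform_brk k) (unit_fun 1) (replicate (Suc j) (unit_fun 0)) =
      filiform_brk k (\<lambda>i. if i = j + 1 then (- 1) ^ j else 0 :: 'k) (unit_fun 0)"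
    using Suc by (simp only: replicate_Suc replicate_append_same[symmetric] foldl_append
        foldl_Cons foldl_Nil Suc_lessD)
  also have "\<dots> = (\<lambda>i. if i = Suc j + 1 then (- 1) ^ Suc j else 0)"
    using Suc.prems by (auto simp: filiform_brk_def unit_fun_def fun_eq_iff)
  finally show ?case .
qed

lemma foldl_filiform_zero: "foldl (filiform_brk k) (\<lambda>i. 0) (replicate j w) = (\<lambda>i. 0)"
proof (induction j)
  case (Suc j)
  have "filiform_brk k (\<lambda>i. 0) w = (\<lambda>i. 0)"
    by (simp add: filiform_brk_def fun_eq_iff)
  then show ?case
    using Suc by simp
qed simp

text \<open>Already \<open>[[x, e\<^sub>1], e\<^sub>1] = [e\<^sub>2, e\<^sub>1] = 0\<close>;
  \<open>k \<ge> 3\<close> ensures that at least two brackets are taken.\<close>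

lemma filiform_reverse_ladder:
  assumes "k \<ge> 3"
  shows "foldl (filiform_brk k) (unit_fun 0) (replicate (k - 1) (unit_fun 1)) =
    (\<lambda>i. 0 :: 'k::field)"
proof -
  have j: "k - 1 = Suc (Suc (k - 3))"
    using assms by simp
  have "filiform_brk k (filiform_brk k (unit_fun 0) (unit_fun 1)) (unit_fun 1) = (\<lambda>i. 0 :: 'k)"
    by (auto simp: filiform_brk_def unit_fun_def fun_eq_iff)
  then show ?thesis
    unfolding j by (simp only: replicate_Suc foldl_Cons foldl_filiform_zero)
qed

section \<open>A linear deformation\<close>

text \<open>The form \<alpha> is closed and the differential of \<beta> is, up to sign, the wedge of
  \<alpha> and \<phi>. Hence the wedge of \<alpha> and \<beta> is a 2-cocycle, its differential
  containing \<alpha> twice.\<close>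

locale bracket_deformation =
  fixes \<mu> :: "('k::field, 'n::finite) bracket"
    and \<alpha> \<beta> \<phi> :: "'k^'n \<Rightarrow> 'k" and z :: "'k^'n"
  assumes lie: "lie_bracket \<mu>"
    and \<alpha>_add: "\<alpha> (x + y) = \<alpha> x + \<alpha> y" and \<alpha>_scale: "\<alpha> (c *s x) = c * \<alpha> x"
    and \<beta>_add: "\<beta> (x + y) = \<beta> x + \<beta> y" and \<beta>_scale: "\<beta> (c *s x) = c * \<beta> x"
    and \<alpha>_bracket: "\<alpha> (\<mu> x y) = 0"
    and \<beta>_bracket: "\<beta> (\<mu> x y) = \<alpha> x * \<phi> y - \<alpha> y * \<phi> x"
    and z_central: "\<mu> z x = 0" and \<alpha>_z: "\<alpha> z = 0" and \<beta>_z: "\<beta> z = 0"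
begin

definition deform :: "'k \<Rightarrow> ('k, 'n) bracket" where
  "deform t x y = \<mu> x y + (t * (\<alpha> x * \<beta> y - \<alpha> y * \<beta> x)) *s z"

lemma bracket_simps:
  "\<mu> (x + y) w = \<mu> x w + \<mu> y w" "\<mu> w (x + y) = \<mu> w x + \<mu> w y"
  "\<mu> (c *s x) w = c *s \<mu> x w" "\<mu> w (c *s x) = c *s \<mu> w x"
  "\<mu> x x = 0" "\<mu> x (\<mu> y w) + \<mu> y (\<mu> w x) + \<mu> w (\<mu> x y) = 0"
  using lie by (simp_all add: lie_bracket_def Vector_Spaces.linear_iff)

lemma z_central_right: "\<mu> x z = 0"
proof -
  have "0 = \<mu> (x + z) (x + z)"
    by (rule bracket_simps(5)[symmetric])
  also have "\<dots> = (\<mu> x x + \<mu> x z) + (\<mu> z x + \<mu> z z)"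
    by (simp only: bracket_simps(1,2) ac_simps)
  also have "\<dots> = \<mu> x z"
    by (simp add: bracket_simps(5) z_central)
  finally show ?thesis by simp
qed

text \<open>There is no term in \<open>t * t\<close>, because \<alpha> and \<beta> vanish on
  \<open>z\<close>; so the linear deformation is a Lie bracket for every \<open>t\<close>, not only
  to first order.\<close>

lemma deform_deform:
  "deform t x (deform t y w) = \<mu> x (\<mu> y w) + (t * (\<alpha> x * (\<alpha> y * \<phi> w - \<alpha> w * \<phi> y))) *s z"
proof -
  let ?v = "deform t y w"
  have "\<mu> x ?v = \<mu> x (\<mu> y w)" "\<alpha> ?v = 0" "\<beta> ?v = \<beta> (\<mu> y w)"
    by (simp_all add: deform_def bracket_simps(2,4) \<alpha>_add \<alpha>_scale \<beta>_add \<beta>_scale \<alpha>_bracket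
        z_central_right \<alpha>_z \<beta>_z)
  then show ?thesis
    by (simp add: deform_def[of t x] \<beta>_bracket)
qed

lemma lie_bracket_deform: "lie_bracket (deform t)"
proof -
  have "deform t x (deform t y w) + deform t y (deform t w x) + deform t w (deform t x y) = 0"
    for x y w
  proof -
    let ?c = "\<lambda>x y w. t * (\<alpha> x * (\<alpha> y * \<phi> w - \<alpha> w * \<phi> y))"
    have "deform t x (deform t y w) + deform t y (deform t w x) + deform t w (deform t x y) =
        (\<mu> x (\<mu> y w) + \<mu> y (\<mu> w x) + \<mu> w (\<mu> x y)) + (?c x y w + ?c y w x + ?c w x y) *s z"
      unfolding deform_deform by (simp only: vector_sadd_rdistrib ac_simps)
    \<comment> \<open>The cyclic sum is the cocycle condition: six products that cancel in
      pairs.\<close>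
    also have "?c x y w + ?c y w x + ?c w x y = 0"
      by (simp add: algebra_simps)
    finally show ?thesis
      by (simp add: bracket_simps(6))
  qed
  then show ?thesis
    by (simp add: lie_bracket_def Vector_Spaces.linear_iff vec.vector_space_axioms)
      (simp add: deform_def bracket_simps(1-5) \<alpha>_add \<alpha>_scale \<beta>_add \<beta>_scale vec_eq_iff algebra_simps)
qed

text \<open>An error along \<open>z\<close> does not spread, since \<open>z\<close> is central for
  \<mu> and killed by \<alpha> and \<beta>.\<close>

lemma foldl_deform: "\<exists>c. foldl (deform t) x xs = foldl \<mu> x xs + c *s z"
proof (induction xs rule: rev_induct)
  case Nil
  show ?case by (simp add: exI[of _ 0])
next
  case (snoc y ys)
  then obtain c where "foldl (deform t) x ys = foldl \<mu> x ys + c *s z"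
    by blast
  then have "foldl (deform t) x (ys @ [y]) = foldl \<mu> x (ys @ [y]) +
      (t * (\<alpha> (foldl \<mu> x ys) * \<beta> y - \<alpha> y * \<beta> (foldl \<mu> x ys))) *s z"
    by (simp add: deform_def bracket_simps(1-4) z_central \<alpha>_add \<alpha>_scale \<beta>_add \<beta>_scale \<alpha>_z \<beta>_z)
  then show ?case by blast
qed

text \<open>After \<open>k\<close> brackets only a multiple of \<open>z\<close> is left, and
  \<open>z\<close> is central for \<open>deform t\<close> too.\<close>

lemma deform_nilp:
  assumes "\<mu> \<in> nilp_brackets k"
  shows "deform t \<in> nilp_brackets (k + 1)"
proof -
  have "foldl (deform t) x xs = 0" if len: "length xs = k + 1" for x xs
  proof -
    obtain ys y where xs: "xs = ys @ [y]" and ys: "length ys = k"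
      using len length_Suc_conv_rev[of xs k] by auto
    obtain c where "foldl (deform t) x ys = c *s z"
      using foldl_deform[of t x ys] assms ys by (auto simp: nilp_brackets_def)
    then show ?thesis
      by (simp add: xs deform_def bracket_simps(3) z_central \<alpha>_scale \<beta>_scale \<alpha>_z \<beta>_z)
  qed
  then show ?thesis
    using lie_bracket_deform by (simp add: nilp_brackets_def)
qed

text \<open>The last bracket, with \<open>y\<close>, is zero for \<mu>, so only the deformation term
  contributes: a nonzero multiple of \<open>z\<close>.\<close>

lemma deform_not_nilp:
  assumes "\<mu> \<in> nilp_brackets k" "length xs + 1 = k" "z \<noteq> 0" "t \<noteq> 0"
    and "\<alpha> y = 1" "\<alpha> (foldl \<mu> x xs) = 0" "\<beta> (foldl \<mu> x xs) \<noteq> 0"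
  shows "deform t \<notin> nilp_brackets k"
proof -
  obtain c where "foldl (deform t) x xs = foldl \<mu> x xs + c *s z"
    using foldl_deform by blast
  moreover have "\<mu> (foldl \<mu> x xs) y = 0"
  proof -
    have "foldl \<mu> x (xs @ [y]) = 0"
      using assms(1,2) by (auto simp: nilp_brackets_def simp del: foldl_append)
    then show ?thesis by simp
  qed
  ultimately have "foldl (deform t) x (xs @ [y]) = (- t * \<beta> (foldl \<mu> x xs)) *s z"
    using assms
    by (simp add: deform_def bracket_simps(1-4) z_central \<alpha>_add \<alpha>_scale \<beta>_add \<beta>_scale \<alpha>_z \<beta>_z)
  then have "foldl (deform t) x (xs @ [y]) \<noteq> 0"
    using assms by simp
  moreover have "length (xs @ [y]) = k"
    using assms by simp
  ultimately show ?thesis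
    unfolding nilp_brackets_def by blast
qed

end

section \<open>Orbits and the Zariski topology\<close>

lemma matrix_inv_mult_vec:
  fixes g :: "'k::field^'n::finite^'n"
  assumes "invertible g"
  shows "matrix_inv g *v (g *v x) = x" "g *v (matrix_inv g *v x) = x"
proof -
  have "g ** matrix_inv g = mat 1 \<and> matrix_inv g ** g = mat 1"
    unfolding matrix_inv_def using assms unfolding invertible_def by (rule someI_ex)
  then show "matrix_inv g *v (g *v x) = x" "g *v (matrix_inv g *v x) = x"
    by (simp_all add: matrix_vector_mul_assoc)
qed

lemma foldl_act:
  fixes g :: "'k::field^'n::finite^'n"
  assumes "invertible g"
  shows "foldl (act g \<mu>) x xs =
    g *v foldl \<mu> (matrix_inv g *v x) (map (\<lambda>x. matrix_inv g *v x) xs)"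
proof (induction xs rule: rev_induct)
  case Nil
  show ?case
    by (simp add: matrix_inv_mult_vec[OF assms])
next
  case (snoc y ys)
  then show ?case
    by (simp add: act_def matrix_inv_mult_vec[OF assms])
qed

text \<open>This invariance separates the deformed brackets from the orbit of \<mu>.\<close>

lemma act_nilp:
  fixes g :: "'k::field^'n::finite^'n"
  assumes "invertible g" "\<mu> \<in> nilp_brackets k"
  shows "act g \<mu> \<in> nilp_brackets k"
proof -
  have \<mu>: "lie_bracket \<mu>" "\<And>x xs. length xs = k \<Longrightarrow> foldl \<mu> x xs = 0"
    using assms(2) by (auto simp: nilp_brackets_def)
  have "act g \<mu> x (act g \<mu> y z) + act g \<mu> y (act g \<mu> z x) + act g \<mu> z (act g \<mu> x y) =
      g *v (\<mu> (matrix_inv g *v x) (\<mu> (matrix_inv g *v y) (matrix_inv g *v z)) +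
        \<mu> (matrix_inv g *v y) (\<mu> (matrix_inv g *v z) (matrix_inv g *v x)) +
        \<mu> (matrix_inv g *v z) (\<mu> (matrix_inv g *v x) (matrix_inv g *v y)))" for x y z
    by (simp add: act_def matrix_inv_mult_vec[OF assms(1)] matrix_vector_right_distrib)
  then have "lie_bracket (act g \<mu>)"
    using \<mu>(1) unfolding lie_bracket_def Vector_Spaces.linear_iff
    by (simp add: vec.vector_space_axioms)
      (simp add: act_def vec.add vec.scale)
  then show ?thesis
    using \<mu>(2) by (simp add: nilp_brackets_def foldl_act[OF assms(1)])
qed

text \<open>Rigidity is stated for structure constants; this brings equalities between them back to
  brackets.\<close>

lemma struct_consts_inj:
  fixes \<mu> \<nu> :: "('k::field, 'n::finite) bracket"
  assumes "lie_bracket \<mu>" "lie_bracket \<nu>" "struct_consts \<mu> = struct_consts \<nu>"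
  shows "\<mu> = \<nu>"
proof -
  have ext: "f = g" if "Vector_Spaces.linear (*s) (*s) f" "Vector_Spaces.linear (*s) (*s) g"
    "\<And>i. f (axis i 1) = g (axis i 1)" for f g :: "'k^'n \<Rightarrow> 'k^'n"
  proof -
    have "matrix f = matrix g"
      using that(3) by (simp add: matrix_def)
    then show ?thesis
      using matrix_works[OF that(1)] matrix_works[OF that(2)] by (metis HOL.ext)
  qed
  have "\<mu> (axis i 1) (axis j 1) = \<nu> (axis i 1) (axis j 1)" for i j
    using assms(3) by (simp add: struct_consts_def fun_eq_iff vec_eq_iff)
  then have "\<mu> (axis i 1) = \<nu> (axis i 1)" for i
    using assms(1,2) unfolding lie_bracket_def by (intro ext) auto
  then have "(\<lambda>x. \<mu> x y) = (\<lambda>x. \<nu> x y)" for y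
    using assms(1,2) unfolding lie_bracket_def by (intro ext) auto
  then show ?thesis
    by (simp add: fun_eq_iff)
qed

lemma polyfun_on_line:
  fixes a b :: "'i \<Rightarrow> 'k::idom"
  assumes "p \<in> polyfun"
  shows "\<exists>q. \<forall>t. p (\<lambda>i. a i + t * b i) = poly q t"
  using assms
proof induction
  case (const c)
  show ?case by (rule exI[of _ "[:c:]"]) simp
next
  case (coord i)
  show ?case by (rule exI[of _ "[:a i, b i:]"]) simp
next
  case (add p q)
  then show ?case by (metis poly_add)
next
  case (mult p q)
  then show ?case by (metis poly_mult)
qed

text \<open>Some polynomial defining the open set is nonzero at \<mu>. On the line it has finitely
  many zeros, while a field of characteristic zero is infinite.\<close>

lemma rigid_line_meets_orbit:
  fixes \<mu> :: "('k::field_char_0, 'n::finite) bracket"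
  assumes "rigid_in j \<mu>" and "\<And>t. \<nu> t \<in> nilp_brackets j"
    and "\<And>t. struct_consts (\<nu> t) = (\<lambda>i. struct_consts \<mu> i + t * b i)"
  shows "\<exists>t. t \<noteq> 0 \<and> \<nu> t \<in> orbit \<mu>"
proof -
  obtain P where P: "P \<subseteq> polyfun" and orbit: "struct_consts ` orbit \<mu> =
      - zero_locus P \<inter> struct_consts ` nilp_brackets j"
    using assms(1) unfolding rigid_in_def openin_subtopology openin_zariski by blast
  have nilp: "\<mu> \<in> nilp_brackets j"
    using assms(1) by (simp add: rigid_in_def)
  have inv: "invertible (mat 1 :: 'k^'n^'n)"
    unfolding invertible_def by (rule exI[of _ "mat 1"]) simp
  have "act (mat 1) \<mu> = \<mu>"
    using matrix_inv_mult_vec(1)[OF inv] by (simp add: act_def fun_eq_iff)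
  then have "\<mu> \<in> orbit \<mu>"
    using inv unfolding orbit_def by (intro CollectI exI[of _ "mat 1"]) simp
  then obtain p where p: "p \<in> P" "p (struct_consts \<mu>) \<noteq> 0"
    using orbit by (auto simp: zero_locus_def)
  obtain q where q: "\<And>t. p (\<lambda>i. struct_consts \<mu> i + t * b i) = poly q t"
    using polyfun_on_line[of p "struct_consts \<mu>" b] p P by blast
  have "poly q 0 \<noteq> 0"
    using p(2) q[of 0] by simp
  \<comment> \<open>Including 0 among the excluded parameters forces
    \<open>t \<noteq> 0\<close>.\<close>
  then have "finite (insert 0 {t. poly q t = 0})"
    by (auto intro: poly_roots_finite)
  then obtain t where t: "t \<notin> insert 0 {t. poly q t = 0}"
    using ex_new_if_finite[OF infinite_UNIV_char_0] by blast
  then have "p (struct_consts (\<nu> t)) \<noteq> 0"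
    using q[of t] by (simp add: assms(3))
  then have "struct_consts (\<nu> t) \<in> - zero_locus P"
    using p(1) by (auto simp: zero_locus_def)
  then obtain \<kappa> where \<kappa>: "\<kappa> \<in> orbit \<mu>" "struct_consts (\<nu> t) = struct_consts \<kappa>"
    using orbit assms(2)[of t] by blast
  have "\<kappa> \<in> nilp_brackets j"
    using \<kappa>(1) act_nilp nilp by (auto simp: orbit_def)
  then have "\<nu> t = \<kappa>"
    using \<kappa>(2) assms(2)[of t] by (intro struct_consts_inj) (auto simp: nilp_brackets_def)
  then show ?thesis
    using \<kappa>(1) t by blast
qed

lemma nilp_brackets_Suc:
  assumes "\<mu> \<in> nilp_brackets k"
  shows "\<mu> \<in> nilp_brackets (k + 1)"
proof -
  have "foldl \<mu> x xs = 0" if len: "length xs = k + 1" for x xs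
  proof -
    obtain y ys where "xs = y # ys" "length ys = k"
      using len length_Suc_conv[of xs k] by auto
    then show ?thesis
      using assms by (simp add: nilp_brackets_def)
  qed
  then show ?thesis
    using assms by (simp add: nilp_brackets_def)
qed


section \<open>Non-rigidity of free nilpotent Lie algebras\<close>

theorem theorem4p1:
  fixes k m :: nat
    and \<mu> :: "('k::{alg_closed_field, field_char_0}, 'n::finite) bracket"
  assumes "k \<ge> 1" and "m \<ge> 2"
    and "\<not> (k = 1 \<and> m = 2)"
    and "CARD('n) = balg_dim (free_nilp k m :: ('k, (magma \<Rightarrow>\<^sub>0 'k) set set) balg)"
    and "balg_iso (coord_alg \<mu>) (free_nilp k m)"
    and "\<not> balg_iso (free_nilp k m :: ('k, (magma \<Rightarrow>\<^sub>0 'k) set set) balg) (free_nilp 2 2)"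
  shows "nonrigid_in (k + 1) \<mu>"
proof -
  note free = free_nilp_coords[OF assms(5,1)]
  have nilp: "\<mu> \<in> nilp_brackets k" and bil: "bilinear_algebra (coord_alg \<mu>)"
    by (rule free)+
  obtain X where X: "\<And>a. \<exists>\<Phi>. alg_hom (coord_alg \<mu>) (filiform k) \<Phi> \<and> (\<forall>i<m. \<Phi> (X i) = a i)"
    using free(3) by blast
  have hom_foldl: "\<Phi> (foldl \<mu> x (replicate j y)) =
      foldl (filiform_brk k) (\<Phi> x) (replicate j (\<Phi> y))"
    if "alg_hom (coord_alg \<mu>) (filiform k) \<Phi>" for \<Phi> x j y
    using alg_hom_foldl[OF bil that, of x "replicate j y"]
    by (simp add: map_replicate_const filiform_def map_replicate)
  have hom_zero: "\<Phi> 0 = (\<lambda>i. 0)" if "alg_hom (coord_alg \<mu>) (filiform k) \<Phi>" for \<Phi>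
    using alg_hom_zer[OF bil bilinear_algebra_filiform that] by (simp add: filiform_def)

  obtain \<Phi> where \<Phi>: "alg_hom (coord_alg \<mu>) (filiform k) \<Phi>"
    and \<Phi>X: "\<And>i. i < m \<Longrightarrow> \<Phi> (X i) = (if i < 2 then unit_fun i else (\<lambda>i. 0))"
    using X[of "\<lambda>i. if i < 2 then unit_fun i else (\<lambda>i. 0)"] by blast
  \<comment> \<open>\<open>z\<close> is \<open>\<plusminus> (ad x\<^sub>2)\<^sup>k\<^sup>-\<^sup>1 x\<^sub>1\<close> if \<open>m = 2\<close> and \<open>\<plusminus> (ad x\<^sub>1)\<^sup>k\<^sup>-\<^sup>1 x\<^sub>3\<close> otherwise; a second homomorphism \<open>\<Psi>\<close>
    to the filiform algebra shows that it is not zero.\<close>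
  obtain i y where z: "\<Phi> (foldl \<mu> (X i) (replicate (k - 1) y)) = (\<lambda>i. 0)"
    "foldl \<mu> (X i) (replicate (k - 1) y) \<noteq> 0"
  proof (cases "m = 2")
    case True
    \<comment> \<open>Reflexivity of \<open>balg_iso\<close> rules out \<open>k = 2\<close>, and
      \<open>k = 1\<close> is excluded by hypothesis: in dimension 2 every nilpotent bracket is
      zero.\<close>
    have "balg_iso (free_nilp 2 2 :: ('k, (magma \<Rightarrow>\<^sub>0 'k) set set) balg) (free_nilp 2 2)"
      unfolding balg_iso_def by (rule exI[of _ id]) simp
    then have k: "k \<ge> 3"
      using assms(1,3,6) True by (cases "k = 2") auto
    \<comment> \<open>\<open>\<Psi>\<close> exchanges the roles of the two generators, so the
      bracket that \<open>\<Phi>\<close> sends to the reverse ladder becomes the ladder ending at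
      \<open>e\<^sub>k\<close>.\<close>
    obtain \<Psi> where \<Psi>: "alg_hom (coord_alg \<mu>) (filiform k) \<Psi>"
      "\<And>i. i < m \<Longrightarrow> \<Psi> (X i) = unit_fun (1 - i)"
      using X[of "\<lambda>i. unit_fun (1 - i)"] by blast
    have "\<Psi> (foldl \<mu> (X 0) (replicate (k - 1) (X 1))) k \<noteq> 0"
      using k True by (simp add: hom_foldl[OF \<Psi>(1)] \<Psi>(2) filiform_ladder[simplified])
    then have "foldl \<mu> (X 0) (replicate (k - 1) (X 1)) \<noteq> 0"
      using hom_zero[OF \<Psi>(1)] by auto
    moreover have "\<Phi> (foldl \<mu> (X 0) (replicate (k - 1) (X 1))) = (\<lambda>i. 0)"
      using filiform_reverse_ladder[OF k] True by (simp add: hom_foldl[OF \<Phi>] \<Phi>X)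
    ultimately show ?thesis by (rule that[rotated])
  next
    case False
    then have m: "m \<ge> 3"
      using assms(2) by simp
    \<comment> \<open>Unlike \<open>\<Phi>\<close>, which kills \<open>X 2\<close>,
      \<open>\<Psi>\<close> sends it to \<open>e\<^sub>1\<close>, the start of the ladder.\<close>
    obtain \<Psi> where \<Psi>: "alg_hom (coord_alg \<mu>) (filiform k) \<Psi>"
      "\<And>i. i < m \<Longrightarrow> \<Psi> (X i) = unit_fun (if i = 0 then 0 else 1)"
      using X[of "\<lambda>i. unit_fun (if i = 0 then 0 else 1)"] by blast
    have "\<Psi> (foldl \<mu> (X 2) (replicate (k - 1) (X 0))) k \<noteq> 0"
      using m assms(1) by (simp add: hom_foldl[OF \<Psi>(1)] \<Psi>(2) filiform_ladder[simplified])
    then have "foldl \<mu> (X 2) (replicate (k - 1) (X 0)) \<noteq> 0"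
      using hom_zero[OF \<Psi>(1)] by auto
    moreover have "\<Phi> (foldl \<mu> (X 2) (replicate (k - 1) (X 0))) = (\<lambda>i. 0)"
      using m by (simp add: hom_foldl[OF \<Phi>] \<Phi>X foldl_filiform_zero)
    ultimately show ?thesis by (rule that[rotated])
  qed

  define z where "z = foldl \<mu> (X i) (replicate (k - 1) y)"
  have "\<mu> z x = 0" for x
  proof -
    have "foldl \<mu> (X i) (replicate (k - 1) y @ [x]) = 0"
      using nilp assms(1) by (auto simp: nilp_brackets_def simp del: foldl_append)
    then show ?thesis by (simp add: z_def)
  qed
  \<comment> \<open>\<phi> is the coordinate along \<open>e\<^sub>k\<^sub>-\<^sub>1\<close>, since
    \<open>[x, e\<^sub>k\<^sub>-\<^sub>1] = e\<^sub>k\<close>. For \<open>k = 1\<close> brackets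
    have no component along \<open>e\<^sub>k\<close>, and \<phi> is set to 0.\<close>
  then interpret bracket_deformation \<mu> "\<lambda>x. \<Phi> x 0" "\<lambda>x. \<Phi> x k"
    "\<lambda>x. if k \<ge> 2 then \<Phi> x (k - 1) else 0" z
    using nilp \<Phi> z(1)
    by unfold_locales (auto simp: nilp_brackets_def alg_hom_def filiform_def filiform_brk_def z_def)

  have not_nilp: "deform t \<notin> nilp_brackets k" if "t \<noteq> 0" for t
  proof (rule deform_not_nilp[OF nilp _ _ that])
    show "length (replicate (k - 1) (X 0)) + 1 = k"
      using assms(1) by simp
    show "z \<noteq> 0"
      using z(2) by (simp add: z_def)
    show "\<Phi> (X 0) 0 = 1"
      using \<Phi>X[of 0] assms(2) by (simp add: unit_fun_def)
    \<comment> \<open>By the ladder the image is \<open>(- 1) ^ (k - 1)\<close> times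
      \<open>e\<^sub>k\<close>.\<close>
    show "\<Phi> (foldl \<mu> (X 1) (replicate (k - 1) (X 0))) 0 = 0"
      "\<Phi> (foldl \<mu> (X 1) (replicate (k - 1) (X 0))) k \<noteq> 0"
      using assms(1,2) by (simp_all add: hom_foldl[OF \<Phi>] \<Phi>X filiform_ladder[simplified])
  qed
  have "\<not> rigid_in (k + 1) \<mu>"
  proof
    assume rigid: "rigid_in (k + 1) \<mu>"
    \<comment> \<open>The structure constants of the bilinear map added to \<mu> at
      \<open>t = 1\<close>, that is, the direction of the line.\<close>
    define b where "b = (\<lambda>(i, j, l). (\<Phi> (axis i 1) 0 * \<Phi> (axis j 1) k -
      \<Phi> (axis j 1) 0 * \<Phi> (axis i 1) k) * z $ l)"
    have "struct_consts (deform t) = (\<lambda>i. struct_consts \<mu> i + t * b i)" for t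
      by (simp add: struct_consts_def deform_def b_def fun_eq_iff)
    from rigid_line_meets_orbit[OF rigid deform_nilp[OF nilp] this]
    obtain t g where "t \<noteq> 0" "deform t = act g \<mu>" "invertible g"
      unfolding orbit_def by blast
    then show False
      using not_nilp[of t] act_nilp[of g \<mu> k] nilp by simp
  qed
  then show ?thesis
    using nilp_brackets_Suc[OF nilp] by (simp add: nonrigid_in_def)
qed

end
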